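(* For every word $w\in A^*$ one has $\pi(\theta(w))=\mathrm{evac}(\pi(w))$.
   Context: $A$ is a finite totally ordered alphabet. $\theta$ denotes the unique order-reversing permutation of $A$, extended to the anti-automorphism of the free monoid $A^*$ (so $\theta(a_1\cdots a_n)=\theta(a_n)\cdots\theta(a_1)$). Tableaux are in French convention (rows numbered from the bottom). An $N$-tableau is a tableau with strictly increasing rows in which each row, viewed as a subset of $A$, is contained in the row below. $N$-insertion of a letter $x$ into a strictly increasing row $B$ gives $B\cup\{x\}$ and bumps a copy of the smallest element of $B$ strictly larger than $x$, if it exists; $N$-insertion into an $N$-tableau inserts into the first row, then the bumped letter into the second row, etc. $N(w)$, for $w=a_1\cdots a_n$, is obtained from the empty tableau by $N$-inserting $a_1,\ldots,a_n$ successively. If the rows of $N(w)$ are $R_1\supset R_2\supset\cdots\supset R_k$ (as sets, from bottom to top), $\pi(w)$ is the set partition of $R_1=\mathrm{Supp}(w)$ with blocks $R_k, R_{k-1}\setminus R_k,\ldots,R_1\setminus R_2$. Blocks of a set partition of a subset of $A$ are ordered by increasing minima, so one can speak of the $j$-th block. The map $\Delta$: let $R=\{B_1,\ldots,B_k\}$ be a partition of a nonempty $B\subseteq A$ with $x_i=\min B_i$, $x_1<\cdots<x_k$; let $u_i$ be the increasing word with support $B_i$ and $w=u_1u_2\cdots u_k$. Define $e(R)$: set $x:=x_1$, $e:=1$; repeatedly, look at the smallest letter to the right of (the occurrence of) $x$ in $w$; if it equals some $x_j$, set $x:=x_j$, $e:=j$ and repeat; otherwise stop and put $e(R)=e$.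 With $e=e(R)$, let $B'_j=(B_j\setminus\{x_j\})\cup\{x_{j+1}\}$ for $j<e$, $B'_e=B_e\setminus\{x_e\}$, and $B'_j=B_j$ for $j>e$; $\Delta(R)$ is the partition of $B\setminus\{\min B\}$ whose blocks are the nonempty $B'_j$. Evacuation: for the empty partition, $\mathrm{evac}$ gives the empty partition. For a partition $R$ of a nonempty $B\subseteq A$, with $b=\min B$, $\mathrm{evac}(R)$ is obtained from $\mathrm{evac}(\Delta(R))$ (defined recursively) by adding the letter $\theta(b)$ to its $e(R)$-th block, creating this block (as a new last block) if $\mathrm{evac}(\Delta(R))$ has fewer than $e(R)$ blocks. *)

theory Defs
  imports "HOL-Combinatorics.Permutations" "HOL-Library.Disjoint_Sets"
begin

section \<open>Order reversal of the alphabet\<close>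

definition order_reversal :: "'a::linorder set \<Rightarrow> 'a \<Rightarrow> 'a" where
  "order_reversal A = (THE f. f permutes A \<and> monotone_on A (<) (>) f)"

definition reverse_word :: "'a::linorder set \<Rightarrow> 'a list \<Rightarrow> 'a list" where
  "reverse_word A w = map (order_reversal A) (rev w)"


section \<open>\<open>N\<close>-insertion\<close>

text \<open>
  A strictly increasing row is represented by its set of letters, and an \<open>N\<close>-tableau by the list
  of its rows from bottom to top (French convention).
\<close>

fun N_insert :: "'a::linorder \<Rightarrow> 'a set list \<Rightarrow> 'a set list" where
  "N_insert x [] = [{x}]"
| "N_insert x (B # T) =
     insert x B # (if \<exists>y\<in>B. x < y then N_insert (Min {y\<in>B. x < y}) T else T)"

definition N_tableau_of :: "'a::linorder list \<Rightarrow> 'a set list" where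
  "N_tableau_of w = foldl (\<lambda>T x. N_insert x T) [] w"

fun row_differences :: "'a set list \<Rightarrow> 'a set set" where
  "row_differences [] = {}"
| "row_differences [R] = {R}"
| "row_differences (R # S # T) = insert (R - S) (row_differences (S # T))"

definition N_partition :: "'a::linorder list \<Rightarrow> 'a set set" where
  "N_partition w = row_differences (N_tableau_of w)"


section \<open>The map \<open>\<Delta>\<close> on set partitions\<close>

definition finite_partition :: "'a set set \<Rightarrow> bool" where
  "finite_partition R \<longleftrightarrow> finite (\<Union>R) \<and> partition_on (\<Union>R) R"

definition blocks :: "'a::linorder set set \<Rightarrow> 'a set list" where
  "blocks R = sorted_key_list_of_set Min R"

text \<open>Blocks are numbered from \<open>1\<close> to \<open>card R\<close>.\<close>

definition block :: "'a::linorder set set \<Rightarrow> nat \<Rightarrow> 'a set" where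
  "block R j = blocks R ! (j - 1)"

definition block_min :: "'a::linorder set set \<Rightarrow> nat \<Rightarrow> 'a" where
  "block_min R j = Min (block R j)"

definition block_word :: "'a::linorder set set \<Rightarrow> 'a list" where
  "block_word R = concat (map sorted_list_of_set (blocks R))"

definition right_of :: "'a \<Rightarrow> 'a list \<Rightarrow> 'a list" where
  "right_of x w = tl (dropWhile (\<lambda>y. y \<noteq> x) w)"

text \<open>
  In \<open>e_walk R v e\<close> the list \<open>v\<close> is the part of the word \<open>block_word R\<close> to the right of the current
  letter \<open>block_min R e\<close>. The letters of that word being distinct, the part to the right of a letter
  of \<open>v\<close> may be computed in \<open>v\<close> instead of the whole word.
\<close>

function e_walk :: "'a::linorder set set \<Rightarrow> 'a list \<Rightarrow> nat \<Rightarrow> nat" where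
  "e_walk R v e =
     (if v \<noteq> [] \<and> (\<exists>j\<in>{1..card R}. block_min R j = Min (set v))
      then e_walk R (right_of (Min (set v)) v)
             (THE j. j \<in> {1..card R} \<and> block_min R j = Min (set v))
      else e)"
  by auto
termination
proof (relation "measure (\<lambda>(R, v, e). length v)")
  fix R :: "'a set set" and v :: "'a list" and e :: nat
  assume "v \<noteq> [] \<and> (\<exists>j\<in>{1..card R}. block_min R j = Min (set v))"
  then have "v \<noteq> []" by blast
  have "length (right_of (Min (set v)) v) \<le> length v - 1"
    unfolding right_of_def using length_dropWhile_le[of "\<lambda>y. y \<noteq> Min (set v)" v] by simp
  with \<open>v \<noteq> []\<close> have "length (right_of (Min (set v)) v) < length v"
    by (cases v) auto
  then show "((R, right_of (Min (set v)) v,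
      THE j. j \<in> {1..card R} \<and> block_min R j = Min (set v)), R, v, e)
      \<in> measure (\<lambda>(R, v, e). length v)"
    by simp
qed simp

declare e_walk.simps [simp del]

definition e_index :: "'a::linorder set set \<Rightarrow> nat" where
  "e_index R = e_walk R (right_of (block_min R 1) (block_word R)) 1"

definition Delta_block :: "'a::linorder set set \<Rightarrow> nat \<Rightarrow> 'a set" where
  "Delta_block R j =
     (if j < e_index R then (block R j - {block_min R j}) \<union> {block_min R (j + 1)}
      else if j = e_index R then block R j - {block_min R j}
      else block R j)"

definition Delta :: "'a::linorder set set \<Rightarrow> 'a set set" where
  "Delta R = Delta_block R ` {1..card R} - {{}}"


section \<open>Evacuation\<close>

lemma (in linorder) sorted_key_list_of_set_inj:
  assumes "finite S" "inj_on f S"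
  shows "set (sorted_key_list_of_set f S) = S"
    and "length (sorted_key_list_of_set f S) = card S"
    and "sorted_wrt (<) (map f (sorted_key_list_of_set f S))"
proof -
  interpret folding_insort_key "(\<le>)" "(<)" S f
    using assms(2) by unfold_locales
  show "set (sorted_key_list_of_set f S) = S"
    "length (sorted_key_list_of_set f S) = card S"
    "sorted_wrt (<) (map f (sorted_key_list_of_set f S))"
    using assms(1) by auto
qed

lemma finite_partition_blocks:
  assumes "finite_partition R"
  shows "set (blocks R) = R" "length (blocks R) = card R"
    and "sorted_wrt (<) (map Min (blocks R))"
    and "\<And>B. B \<in> R \<Longrightarrow> finite B \<and> B \<noteq> {}"
proof -
  have fin: "finite R" using assms by (simp add: finite_partition_def finite_UnionD)
  show fB: "finite B \<and> B \<noteq> {}" if "B \<in> R" for B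
    using assms that unfolding finite_partition_def partition_on_def
    by (meson Union_upper finite_subset)
  have "inj_on Min R"
  proof (rule inj_onI)
    fix B C assume BC: "B \<in> R" "C \<in> R" "Min B = Min C"
    then have "Min B \<in> B \<inter> C" using fB by (metis IntI Min_in)
    then show "B = C"
      using assms BC unfolding finite_partition_def partition_on_def disjoint_def by blast
  qed
  from sorted_key_list_of_set_inj[OF fin this]
  show "set (blocks R) = R" "length (blocks R) = card R"
    "sorted_wrt (<) (map Min (blocks R))"
    unfolding blocks_def by auto
qed

lemma block_min_less:
  assumes "finite_partition R" "1 \<le> i" "i < j" "j \<le> card R"
  shows "block_min R i < block_min R j"
  using finite_partition_blocks(2,3)[OF assms(1)] assms(2-)
  unfolding block_min_def block_def
  by (auto simp: sorted_wrt_iff_nth_less)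

lemma block_in:
  assumes "finite_partition R" "j \<in> {1..card R}"
  shows "block R j \<in> R" "block_min R j \<in> block R j"
proof -
  show "block R j \<in> R"
    using finite_partition_blocks(1,2)[OF assms(1)] assms(2) nth_mem[of "j - 1" "blocks R"]
    unfolding block_def by force
  then show "block_min R j \<in> block R j"
    using finite_partition_blocks(4)[OF assms(1)] unfolding block_min_def by simp
qed

lemma e_walk_bounds:
  assumes "finite_partition R" "e \<in> {1..card R}"
  shows "e_walk R v e \<in> {1..card R}"
  using assms
proof (induction R v e rule: e_walk.induct)
  case (1 R v e)
  show ?case
  proof (cases "v \<noteq> [] \<and> (\<exists>j\<in>{1..card R}. block_min R j = Min (set v))")
    case True
    let ?P = "\<lambda>j. j \<in> {1..card R} \<and> block_min R j = Min (set v)"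
    obtain j where j: "?P j" using True by blast
    have "i = j" if "?P i" for i
      using that j block_min_less[OF 1(2), of i j] block_min_less[OF 1(2), of j i]
      by (cases i j rule: linorder_cases) auto
    then have "?P (THE j. ?P j)" using theI[of ?P, OF j] by blast
    then show ?thesis
      using 1(1)[OF True 1(2)] True by (subst e_walk.simps) auto
  next
    case False
    then show ?thesis using 1(3) by (subst e_walk.simps) auto
  qed
qed

lemma card_Union_Delta:
  assumes R: "finite_partition R" "R \<noteq> {}"
  shows "card (\<Union>(Delta R)) < card (\<Union>R)"
proof -
  have "finite R" using R by (simp add: finite_partition_def finite_UnionD)
  then have one: "1 \<in> {1..card R}" using R(2) by (simp add: Suc_leI card_gt_0_iff)
  have e: "e_index R \<in> {1..card R}"
    unfolding e_index_def using e_walk_bounds[OF R(1) one] .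
  let ?x = "block_min R 1"
  have sub: "Delta_block R j \<subseteq> \<Union>R - {?x}" if j: "j \<in> {1..card R}" for j
  proof -
    have x: "?x \<notin> block R j - {block_min R j}"
    proof (cases "j = 1")
      case False
      then have "?x < block_min R j" using j block_min_less[OF R(1), of 1 j] by auto
      then show ?thesis
        using finite_partition_blocks(4)[OF R(1) block_in(1)[OF R(1) j]]
        unfolding block_min_def[of R j] by auto
    qed auto
    have j1: "block_min R (j + 1) \<in> \<Union>R - {?x}" if "j < e_index R"
      using that e j block_in[OF R(1), of "j + 1"] block_min_less[OF R(1), of 1 "j + 1"] by auto
    have "?x \<noteq> block_min R j" if "j > e_index R"
      using that e j block_min_less[OF R(1), of 1 j] by auto
    then show ?thesis
      using x j1 block_in[OF R(1) j] unfolding Delta_block_def by auto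
  qed
  have "\<Union>(Delta R) \<subseteq> \<Union>R - {?x}"
    using sub unfolding Delta_def by blast
  moreover have "?x \<in> \<Union>R" using block_in[OF R(1) one] by blast
  ultimately show ?thesis
    using R(1) unfolding finite_partition_def by (intro psubset_card_mono) blast+
qed

text \<open>
  \<open>evac A\<close> is meant for partitions of subsets of the finite set \<open>A\<close>; the value \<open>{}\<close> on families that
  are not finite partitions is a dummy.
\<close>

function evac :: "'a::linorder set \<Rightarrow> 'a set set \<Rightarrow> 'a set set" where
  "evac A R =
     (if R = {} \<or> \<not> finite_partition R then {}
      else let S = evac A (Delta R); e = e_index R; t = order_reversal A (Min (\<Union>R))
           in if card S < e then insert {t} S
              else insert (insert t (block S e)) (S - {block S e}))"
  by auto
termination
  by (relation "measure (\<lambda>(A, R). card (\<Union>R))") (auto intro: card_Union_Delta)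

declare evac.simps [simp del]

end

(*
The height of a letter z in N(w) is the number of rows of N(w) that contain z; the i-th block of
pi(w) is the set of letters of height i. Heights encode longest decreasing subsequences: for every
interval of the alphabet, read in increasing order z1 < z2 < ..., the counter that starts at 0 and
increases at zj whenever the height of zj exceeds it ends at the maximal length of a strictly
decreasing subsequence of w with letters in that interval. Since theta maps intervals to intervals
and turns strictly decreasing subsequences of w into those of theta(w), the heights of w and of
theta(w) determine each other.

Let b be the least letter. On intervals that avoid b, Delta does not change the counters. The height
h of theta(b) in N(theta(w)) is determined by the condition that, for every initial segment I of the
letters above b, h exceeds the counter of I iff adding b to I raises the counter; the index e(pi(w))
satisfies the same condition, so h = e(pi(w)) and evacuation is correct by induction.
*)

theory Submission
  imports Defs "HOL-Library.Sublist"
begin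

section \<open>Counters and restricted growth\<close>

primrec climb :: "('a \<Rightarrow> nat) \<Rightarrow> nat \<Rightarrow> 'a list \<Rightarrow> nat" where
  "climb f n [] = n"
| "climb f n (z # zs) = climb f (if n < f z then Suc n else n) zs"

text \<open>
  Restricted growth: no value exceeds the running maximum by more than \<open>1\<close>. Under this condition
  \<open>climb\<close> from \<open>0\<close> computes the running maximum.
\<close>

primrec growth :: "('a \<Rightarrow> nat) \<Rightarrow> nat \<Rightarrow> 'a list \<Rightarrow> bool" where
  "growth f n [] \<longleftrightarrow> True"
| "growth f n (z # zs) \<longleftrightarrow> f z \<le> Suc n \<and> growth f (if n < f z then Suc n else n) zs"

text \<open>
  The effect of \<open>N\<close>-insertion of \<open>x\<close> on the heights of the letters above \<open>x\<close>: the letter bumped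
  into row \<open>n + 2\<close> is the least one to the right of the previous one that lies in row \<open>n + 1\<close>.
\<close>

primrec bump :: "('a \<Rightarrow> nat) \<Rightarrow> nat \<Rightarrow> 'a list \<Rightarrow> 'a \<Rightarrow> nat" where
  "bump f n [] = f"
| "bump f n (z # zs) =
     (bump f (if n < f z then Suc n else n) zs)(z := if f z = Suc n then Suc (Suc n) else f z)"

lemma climb_append: "climb f n (us @ vs) = climb f (climb f n us) vs"
  by (induction us arbitrary: n) auto

lemma growth_append: "growth f n (us @ vs) \<longleftrightarrow> growth f n us \<and> growth f (climb f n us) vs"
  by (induction us arbitrary: n) auto

lemma climb_cong: "(\<And>z. z \<in> set zs \<Longrightarrow> f z = g z) \<Longrightarrow> climb f n zs = climb g n zs"
  by (induction zs arbitrary: n) auto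

lemma growth_cong: "(\<And>z. z \<in> set zs \<Longrightarrow> f z = g z) \<Longrightarrow> growth f n zs = growth g n zs"
  by (induction zs arbitrary: n) auto

lemma climb_ge: "n \<le> climb f n zs"
  by (induction zs arbitrary: n) (auto intro: Suc_leD)

lemma climb_mono: "m \<le> n \<Longrightarrow> climb f m zs \<le> climb f n zs"
  by (induction zs arbitrary: m n) auto

text \<open>The two counters move together except at a letter one above the lower counter; there the
  lower one catches up, and from then on they agree.\<close>

lemma climb_Suc_le: "climb f (Suc n) zs \<le> Suc (climb f n zs)"
proof (induction zs arbitrary: n)
  case (Cons z zs)
  then show ?case using Cons[of n] Cons[of "Suc n"]
    by (auto simp: not_less intro: order_trans[OF climb_mono])
qed simp

lemma growth_le_climb:
  "growth f n zs \<Longrightarrow> z \<in> set zs \<Longrightarrow> f z \<le> climb f n zs"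
proof (induction zs arbitrary: n)
  case (Cons y zs)
  then show ?case
    using climb_ge[of "if n < f y then Suc n else n" f zs] by (auto split: if_splits)
qed simp

text \<open>A counter rises by one at a time, and growth forces a letter that raises it to
  \<open>i\<close> to have height exactly \<open>i\<close>.\<close>

lemma growth_attained:
  "growth f n zs \<Longrightarrow> n < i \<Longrightarrow> i \<le> climb f n zs \<Longrightarrow> \<exists>z\<in>set zs. f z = i"
proof (induction zs arbitrary: n)
  case (Cons y zs)
  show ?case
  proof (cases "f y = i")
    case False
    then have "\<exists>z\<in>set zs. f z = i"
      using Cons.prems by (intro Cons.IH) (auto split: if_splits)
    then show ?thesis by auto
  qed auto
qed simp

text \<open>Growth puts the counter before \<open>z\<close> at \<open>f z - 1\<close> or more, so it
  has reached \<open>i\<close> already. Hence block minima will increase with the height.\<close>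

lemma growth_attained_before:
  assumes "growth f n zs" "sorted_wrt (<) zs" "z \<in> set zs" "n < i" "i < f z"
  shows "\<exists>y\<in>set zs. y < z \<and> f y = i"
  using assms
proof (induction zs arbitrary: n)
  case (Cons x zs)
  show ?case
  proof (cases "z = x \<or> f x = i")
    case False
    then have "\<exists>y\<in>set zs. y < z \<and> f y = i"
      using Cons.prems by (intro Cons.IH[of "if n < f x then Suc n else n"]) (auto split: if_splits)
    then show ?thesis by auto
  qed (use Cons.prems in auto)
qed simp

text \<open>Steps of size at most one cannot jump over a value. This later separates two numbers by
  the counter of a suitable initial segment.\<close>

lemma climb_prefix_attained:
  "i \<le> climb f 0 zs \<Longrightarrow> \<exists>us vs. zs = us @ vs \<and> climb f 0 us = i"
proof (induction zs rule: rev_induct)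
  case (snoc z zs)
  show ?case
  proof (cases "i \<le> climb f 0 zs")
    case True
    then show ?thesis using snoc.IH by (metis append.assoc)
  next
    case False
    then have "i = climb f 0 (zs @ [z])"
      using snoc.prems by (auto simp: climb_append split: if_splits)
    then show ?thesis by (metis append_Nil2)
  qed
qed simp

section \<open>Bumping along the letters above the inserted one\<close>

lemma bump_notin: "z \<notin> set zs \<Longrightarrow> bump f n zs z = f z"
  by (induction zs arbitrary: n) auto

lemma bump_eq_0: "f z = 0 \<Longrightarrow> bump f n zs z = 0"
  by (induction zs arbitrary: n) auto

lemma bump_append_right:
  "z \<notin> set us \<Longrightarrow> bump f n (us @ vs) z = bump f (climb f n us) vs z"
  by (induction us arbitrary: n) auto

text \<open>For the letters between the inserted letter and the first one bumped: a height of at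
  most \<open>n\<close> neither advances the level nor gets raised.\<close>

lemma bump_skip:
  assumes "distinct (us @ vs)" "\<And>z. z \<in> set us \<Longrightarrow> f z \<le> n"
  shows "bump f n (us @ vs) = bump f n vs"
  using assms
proof (induction us)
  case (Cons z us)
  then have "f z \<le> n" "bump f n (us @ vs) = bump f n vs" by auto
  then show ?case using Cons.prems(1) by (auto simp: bump_notin fun_upd_idem)
qed simp

text \<open>For the induction over rows: without the bottom row \<open>B\<close> the heights of its
  letters drop by one, and so does the level at which bumping starts.\<close>

lemma bump_rows:
  assumes "\<And>z. z \<notin> B \<Longrightarrow> g z = 0"
  shows "bump (\<lambda>z. if z \<in> B then Suc (g z) else 0) (Suc n) zs
       = (\<lambda>z. if z \<in> B then Suc (bump g n zs z) else 0)"
proof (induction zs arbitrary: n)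
  case (Cons z zs)
  show ?case
    by (auto simp: Cons fun_eq_iff assms)
qed (simp add: fun_eq_iff)

text \<open>Invariant: the new counter is the maximum of the old counter \<open>k\<close> and one
  more than the bump level \<open>n\<close>. The level itself moves like an old counter, which gives
  the second argument of \<open>max\<close>; a raised letter gets height \<open>Suc (Suc n)\<close>,
  just enough to keep the new counter above the level.\<close>

lemma climb_bump:
  assumes "distinct (vs @ ts)"
  shows "climb (bump f n (vs @ ts)) (max k (Suc n)) vs = max (climb f k vs) (Suc (climb f n vs))"
  using assms
proof (induction vs arbitrary: k n)
  case (Cons z vs)
  let ?n = "if n < f z then Suc n else n" and ?k = "if k < f z then Suc k else k"
  let ?g = "bump f n ((z # vs) @ ts)"
  have "(if max k (Suc n) < ?g z then Suc (max k (Suc n)) else max k (Suc n)) = max ?k (Suc ?n)"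
    by (auto simp: max_def)
  then have "climb ?g (max k (Suc n)) (z # vs) = climb ?g (max ?k (Suc ?n)) vs"
    by simp
  also have "\<dots> = climb (bump f ?n (vs @ ts)) (max ?k (Suc ?n)) vs"
    using Cons.prems by (intro climb_cong) auto
  also have "\<dots> = max (climb f ?k vs) (Suc (climb f ?n vs))"
    using Cons.prems by (intro Cons.IH) auto
  finally show ?case by (simp only: climb.simps)
qed simp

text \<open>Same invariant as in \<open>climb_bump\<close>: a raised letter reaches
  \<open>Suc (Suc n)\<close>, at most one above a counter that is at least
  \<open>Suc n\<close>.\<close>

lemma growth_bump:
  assumes "distinct vs" "growth f k vs"
  shows "growth (bump f n vs) (max k (Suc n)) vs"
  using assms
proof (induction vs arbitrary: k n)
  case (Cons z vs)
  let ?n = "if n < f z then Suc n else n" and ?k = "if k < f z then Suc k else k"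
  let ?g = "bump f n (z # vs)"
  have *: "(if max k (Suc n) < ?g z then Suc (max k (Suc n)) else max k (Suc n)) = max ?k (Suc ?n)"
    by (auto simp: max_def)
  have "growth ?g (max ?k (Suc ?n)) vs \<longleftrightarrow> growth (bump f ?n vs) (max ?k (Suc ?n)) vs"
    using Cons.prems by (intro growth_cong) auto
  moreover have "growth (bump f ?n vs) (max ?k (Suc ?n)) vs"
    using Cons.prems by (intro Cons.IH) auto
  moreover have "?g z \<le> Suc (max k (Suc n))"
    using Cons.prems by auto
  ultimately show ?case
    unfolding growth.simps * by simp
qed simp

text \<open>A counter that is not above the bump level does not notice the change: a raised letter
  exceeds it before and after, and it never overtakes the level.\<close>

lemma climb_bump_low:
  assumes "distinct (vs @ ts)" "k \<le> n"
  shows "climb (bump f n (vs @ ts)) k vs = climb f k vs"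
  using assms
proof (induction vs arbitrary: k n)
  case (Cons z vs)
  let ?n = "if n < f z then Suc n else n" and ?k = "if k < f z then Suc k else k"
  let ?g = "bump f n ((z # vs) @ ts)"
  have "(if k < ?g z then Suc k else k) = ?k"
    using Cons.prems(2) by auto
  then have "climb ?g k (z # vs) = climb ?g ?k vs"
    by simp
  also have "\<dots> = climb (bump f ?n (vs @ ts)) ?k vs"
    using Cons.prems by (intro climb_cong) auto
  also have "\<dots> = climb f ?k vs"
    using Cons.prems by (intro Cons.IH) auto
  finally show ?case by (simp only: climb.simps)
qed simp

section \<open>The effect of one insertion on the counters\<close>

text \<open>\<open>zs\<close> stands for the increasing list of the letters above \<open>x\<close>.
  A new letter \<open>x\<close> enters the bottom row only and gets height 1; a letter already
  present keeps its height.\<close>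

definition insert_height :: "'a \<Rightarrow> 'a list \<Rightarrow> ('a \<Rightarrow> nat) \<Rightarrow> 'a \<Rightarrow> nat" where
  "insert_height x zs f = (bump f 0 zs)(x := max 1 (f x))"

text \<open>The maximum mirrors the decreasing subsequences after appending \<open>x\<close>: the
  old ones, and those that end in \<open>x\<close> after letters from \<open>vs\<close>. The letter
  \<open>x\<close> lifts the counter to at least 1, which is the situation of
  \<open>climb_bump\<close> at level 0.\<close>

lemma climb_insert_height:
  assumes "distinct (us @ x # vs @ ts)"
  shows "climb (insert_height x (vs @ ts) f) 0 (us @ x # vs)
       = max (climb f 0 (us @ x # vs)) (Suc (climb f 0 vs))"
proof -
  let ?g = "insert_height x (vs @ ts) f"
  let ?k = "climb f 0 us"
  have "climb ?g 0 us = ?k"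
    using assms by (intro climb_cong) (auto simp: insert_height_def disjoint_iff intro!: bump_notin)
  then have "climb ?g 0 (us @ x # vs) = climb ?g (max (if ?k < f x then Suc ?k else ?k) (Suc 0)) vs"
    by (auto simp: climb_append insert_height_def max_def intro!: arg_cong[where f = "\<lambda>n. climb _ n _"])
  also have "\<dots> = climb (bump f 0 (vs @ ts)) (max (if ?k < f x then Suc ?k else ?k) (Suc 0)) vs"
    using assms by (intro climb_cong) (auto simp: insert_height_def)
  finally show ?thesis
    using assms by (simp add: climb_bump climb_append)
qed

text \<open>When bumping arrives at \<open>vs\<close>, its level is \<open>climb f 0 us\<close>, not
  below the start 0 of the counter on \<open>vs\<close>, so \<open>climb_bump_low\<close>
  applies.\<close>

lemma climb_insert_height_right:
  assumes "distinct (x # us @ vs @ ts)"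
  shows "climb (insert_height x (us @ vs @ ts) f) 0 vs = climb f 0 vs"
proof -
  have "climb (insert_height x (us @ vs @ ts) f) 0 vs
      = climb (bump f (climb f 0 us) (vs @ ts)) 0 vs"
  proof (intro climb_cong)
    fix z assume "z \<in> set vs"
    with assms have "z \<noteq> x" "z \<notin> set us" by auto
    then show "insert_height x (us @ vs @ ts) f z = bump f (climb f 0 us) (vs @ ts) z"
      by (simp add: insert_height_def bump_append_right)
  qed
  also have "\<dots> = climb f 0 vs"
    using assms by (intro climb_bump_low) auto
  finally show ?thesis .
qed

lemma climb_insert_height_notin:
  assumes "x \<notin> set vs" "set vs \<inter> set zs = {}"
  shows "climb (insert_height x zs f) n vs = climb f n vs"
  using assms by (intro climb_cong) (auto simp: insert_height_def disjoint_iff intro!: bump_notin)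

lemma growth_insert_height:
  assumes "distinct (us @ x # vs)" "growth f 0 (us @ x # vs)"
  shows "growth (insert_height x vs f) 0 (us @ x # vs)"
proof -
  let ?g = "insert_height x vs f"
  let ?k = "climb f 0 us"
  let ?k' = "if ?k < f x then Suc ?k else ?k"
  have eq: "climb ?g 0 us = ?k"
    using assms by (intro climb_insert_height_notin) auto
  have "growth ?g 0 us \<longleftrightarrow> growth f 0 us"
    using assms by (intro growth_cong) (auto simp: insert_height_def disjoint_iff intro!: bump_notin)
  moreover have "growth ?g (max ?k' (Suc 0)) vs \<longleftrightarrow> growth (bump f 0 vs) (max ?k' (Suc 0)) vs"
    using assms by (intro growth_cong) (auto simp: insert_height_def)
  moreover have "growth (bump f 0 vs) (max ?k' (Suc 0)) vs"
    using assms by (intro growth_bump) (auto simp: growth_append)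
  moreover have "(if ?k < ?g x then Suc ?k else ?k) = max ?k' (Suc 0)"
    by (auto simp: insert_height_def max_def)
  moreover have "?g x \<le> Suc ?k"
    using assms(2) by (auto simp: insert_height_def growth_append)
  ultimately show ?thesis
    using assms(2) by (simp add: growth_append eq)
qed

section \<open>Heights in a tableau\<close>

definition row_count :: "'a set list \<Rightarrow> 'a \<Rightarrow> nat" where
  "row_count T z = length (filter (\<lambda>R. z \<in> R) T)"

lemma row_count_eq_0_iff: "row_count T z = 0 \<longleftrightarrow> z \<notin> \<Union>(set T)"
  by (auto simp: row_count_def filter_empty_conv)

lemma row_count_Cons:
  assumes "sorted_wrt (\<supseteq>) (B # T)"
  shows "row_count (B # T) = (\<lambda>z. if z \<in> B then Suc (row_count T z) else 0)"
proof
  fix z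
  have "row_count T z = 0" if "z \<notin> B"
    unfolding row_count_eq_0_iff using assms that by auto
  then show "row_count (B # T) z = (if z \<in> B then Suc (row_count T z) else 0)"
    by (auto simp: row_count_def)
qed

lemma Union_N_insert:
  assumes "\<And>R. R \<in> set T \<Longrightarrow> finite R"
  shows "\<Union>(set (N_insert x T)) = insert x (\<Union>(set T))"
  using assms
proof (induction T arbitrary: x)
  case (Cons B T)
  show ?case
  proof (cases "\<exists>y\<in>B. x < y")
    case True
    with Cons.prems have "Min {y\<in>B. x < y} \<in> {y\<in>B. x < y}" by (intro Min_in) auto
    then show ?thesis using Cons True by auto
  qed auto
qed simp

text \<open>Finite rows make the minimum in \<open>N_insert\<close> meaningful; nonempty ones ensure
  that the top row has a letter, which then lies in all rows.\<close>

definition nested_rows :: "'a set list \<Rightarrow> bool" where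
  "nested_rows T \<longleftrightarrow> sorted_wrt (\<supseteq>) T \<and> (\<forall>R\<in>set T. finite R \<and> R \<noteq> {})"

lemma nested_rows_Cons:
  "nested_rows (B # T) \<longleftrightarrow> finite B \<and> B \<noteq> {} \<and> \<Union>(set T) \<subseteq> B \<and> nested_rows T"
  unfolding nested_rows_def by (simp add: Sup_le_iff) blast

lemma nested_rows_finite: "nested_rows T \<Longrightarrow> R \<in> set T \<Longrightarrow> finite R"
  by (simp add: nested_rows_def)

lemma nested_rows_N_insert: "nested_rows T \<Longrightarrow> nested_rows (N_insert x T)"
proof (induction T arbitrary: x)
  case Nil
  show ?case by (simp add: nested_rows_def)
next
  case (Cons B T)
  then have BT: "finite B" "\<Union>(set T) \<subseteq> B" "nested_rows T"
    unfolding nested_rows_Cons by blast+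
  show ?case
  proof (cases "\<exists>y\<in>B. x < y")
    case True
    let ?y = "Min {y\<in>B. x < y}"
    from True BT(1) have "?y \<in> {y\<in>B. x < y}"
      by (intro Min_in) auto
    then have yB: "?y \<in> B" by simp
    have Un: "\<Union>(set (N_insert ?y T)) = insert ?y (\<Union>(set T))"
      using nested_rows_finite[OF BT(3)] by (rule Union_N_insert)
    have "\<Union>(set (N_insert ?y T)) \<subseteq> insert x B"
      unfolding Un using yB BT(2) by (simp add: subset_insertI2)
    with True show ?thesis
      using BT(1) Cons.IH[OF BT(3)] by (simp add: nested_rows_Cons)
  next
    case False
    then show ?thesis
      using BT by (auto simp: nested_rows_Cons)
  qed
qed

text \<open>Induction over the rows: for the rows above \<open>B\<close>, the bumped letter
  \<open>?y\<close> takes the role of \<open>x\<close>, and the part \<open>q\<close> of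
  \<open>zs\<close> above \<open>?y\<close> that of \<open>zs\<close>. The list may contain letters
  outside the tableau, since the upper rows need not contain all of \<open>q\<close>.\<close>

lemma row_count_N_insert:
  assumes "nested_rows T" "sorted_wrt (<) (x # zs)" "\<And>y. y \<in> \<Union>(set T) \<Longrightarrow> x < y \<Longrightarrow> y \<in> set zs"
  shows "row_count (N_insert x T) = insert_height x zs (row_count T)"
  using assms
proof (induction T arbitrary: x zs)
  case Nil
  have 0: "row_count [] = (\<lambda>_. 0)" by (simp add: row_count_def fun_eq_iff)
  have "bump (\<lambda>_. 0) 0 zs = (\<lambda>_. 0)"
    using bump_skip[of zs "[]" "\<lambda>_. 0" 0] Nil(2) by (simp add: strict_sorted_iff)
  then show ?case
    by (simp add: insert_height_def 0) (simp add: row_count_def fun_eq_iff)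
next
  case (Cons B T)
  let ?f = "row_count (B # T)" and ?g = "row_count T"
  from Cons.prems have nested: "sorted_wrt (\<supseteq>) (B # T)" "nested_rows T" "finite B"
    by (simp_all add: nested_rows_def)
  note f = row_count_Cons[OF nested(1)]
  have g0: "?g z = 0" if "z \<notin> B" for z
    unfolding row_count_eq_0_iff using nested that by auto
  have zs: "distinct zs" "x \<notin> set zs" "\<And>z. z \<in> set zs \<Longrightarrow> x < z"
    using Cons.prems(2) by (auto simp: strict_sorted_iff)
  have row_count: "row_count (insert x B # S) z
      = (if z \<in> insert x B then Suc (row_count S z) else row_count S z)" for S z
    by (auto simp: row_count_def)
  show ?case
  proof (cases "\<exists>y\<in>B. x < y")
    case True
    let ?y = "Min {y\<in>B. x < y}"
    from True nested(3) have y: "?y \<in> {y\<in>B. x < y}"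
      by (intro Min_in) auto
    then have "?y \<in> set zs" using Cons.prems(3) by auto
    then obtain p q where pq: "zs = p @ ?y # q" by (auto dest: split_list)
    \<comment> \<open>By the choice of \<open>?y\<close>, the letters between \<open>x\<close> and
      \<open>?y\<close> are not in \<open>B\<close>, so bumping passes over them.\<close>
    have p: "?f z = 0" if "z \<in> set p" for z
    proof -
      from that pq Cons.prems(2) have "x < z" "z < ?y"
        by (auto simp: sorted_wrt_append)
      then show ?thesis using nested(3) unfolding f by (auto simp: not_le[symmetric])
    qed
    have q: "sorted_wrt (<) (?y # q)"
      using Cons.prems(2) pq by (metis sorted_wrt.simps(2) sorted_wrt_append)
    have above_y: "z \<in> set q" if "z \<in> \<Union>(set T)" "?y < z" for z
    proof -
      from that y have "z \<in> set zs" using Cons.prems(3)[of z] by (auto intro: order.strict_trans)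
      moreover have "z \<notin> set p"
        using that Cons.prems(2) pq by (auto simp: sorted_wrt_append dest: order.asym)
      ultimately show ?thesis using pq that by auto
    qed
    have IH: "row_count (N_insert ?y T) z = insert_height ?y q ?g z" for z
      using Cons.IH[OF nested(2) q] above_y by metis
    have "bump ?f 0 zs = bump ?f 0 (?y # q)"
      unfolding pq using p pq zs(1) by (intro bump_skip) auto
    \<comment> \<open>If \<open>?y\<close> is only in \<open>B\<close>, it is copied into the second
      row and gets height 2; otherwise it is there already and keeps its height.
      \<open>max 1\<close> covers both cases.\<close>
    also have "\<dots> = (bump ?f (Suc 0) q)(?y := Suc (max 1 (?g ?y)))"
      using y by (auto simp: f fun_eq_iff)
    also have "bump ?f (Suc 0) q = (\<lambda>z. if z \<in> B then Suc (bump ?g 0 q z) else 0)"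
      unfolding f by (intro bump_rows g0)
    finally have *: "bump ?f 0 zs = (\<lambda>z. if z \<in> B then Suc (bump ?g 0 q z) else 0)
        (?y := Suc (max 1 (?g ?y)))" .
    have xq: "x \<noteq> ?y" "x \<notin> set q" using zs(2) pq by auto
    have b0: "bump ?g 0 q z = 0" if "z \<notin> B" for z
      by (intro bump_eq_0 g0 that)
    show ?thesis
    proof
      fix z
      have "row_count (N_insert x (B # T)) z
          = (if z \<in> insert x B then Suc (insert_height ?y q ?g z) else insert_height ?y q ?g z)"
        using True by (simp add: row_count IH)
      also have "\<dots> = insert_height x zs ?f z"
      proof -
        consider "z = x" | "z = ?y" | "z \<noteq> x" "z \<noteq> ?y" by blast
        then show ?thesis
        proof cases
          case 1
          then have "insert_height ?y q ?g z = ?g x"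
            using xq by (simp add: insert_height_def bump_notin)
          then show ?thesis
            using 1 g0[of x] by (simp add: insert_height_def f)
        next
          case 2
          have "?y \<in> B" "?y \<noteq> x" using y by auto
          then show ?thesis unfolding 2 insert_height_def * by simp
        next
          case 3
          then have "insert_height ?y q ?g z = bump ?g 0 q z"
            by (simp add: insert_height_def)
          moreover have "insert_height x zs ?f z = (if z \<in> B then Suc (bump ?g 0 q z) else 0)"
            unfolding insert_height_def * using 3 by simp
          ultimately show ?thesis
            using 3 b0[of z] by simp
        qed
      qed
      finally show "row_count (N_insert x (B # T)) z = insert_height x zs ?f z" .
    qed
  next
    case False
    \<comment> \<open>Nothing in \<open>B\<close> exceeds \<open>x\<close>, so all letters of
      \<open>zs\<close> have height 0 and nothing is bumped.\<close>
    have "?f z \<le> 0" if "z \<in> set zs" for z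
      using zs(3)[OF that] False by (auto simp: f)
    then have "bump ?f 0 zs = bump ?f 0 []"
      using bump_skip[of zs "[]" ?f 0] zs(1) by simp
    then show ?thesis
      using False g0 by (auto simp: insert_height_def fun_eq_iff f row_count)
  qed
qed

section \<open>Decreasing subsequences with letters in a given set\<close>

definition dec_subseq :: "'a::linorder list \<Rightarrow> 'a set \<Rightarrow> nat \<Rightarrow> bool" where
  "dec_subseq w S n \<longleftrightarrow> (\<exists>u. subseq u w \<and> sorted_wrt (>) u \<and> set u \<subseteq> S \<and> length u = n)"

lemma dec_subseq_Nil [simp]: "dec_subseq [] S n \<longleftrightarrow> n = 0"
  by (auto simp: dec_subseq_def)

text \<open>A subsequence that uses the final \<open>x\<close> decreases only if all its other
  letters exceed \<open>x\<close>; \<open>climb_insert_height\<close> gives the same recursion for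
  counters.\<close>

lemma dec_subseq_snoc:
  "dec_subseq (w @ [x]) S n \<longleftrightarrow>
     dec_subseq w S n \<or> x \<in> S \<and> (\<exists>m. n = Suc m \<and> dec_subseq w {y\<in>S. x < y} m)"
  (is "?L \<longleftrightarrow> ?R")
proof
  assume ?L
  then obtain u where u: "subseq u (w @ [x])" "sorted_wrt (>) u" "set u \<subseteq> S" "length u = n"
    by (auto simp: dec_subseq_def)
  then obtain u1 u2 where *: "u = u1 @ u2" "subseq u1 w" "subseq u2 [x]"
    by (auto simp: subseq_append_iff)
  from *(3) have "u2 = [] \<or> u2 = [x]"
    by (cases u2) (auto simp: subseq_singleton_left split: if_splits)
  then show ?R
  proof
    assume "u2 = []"
    then have "dec_subseq w S n"
      using u * unfolding dec_subseq_def by (intro exI[of _ u]) simp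
    then show ?R ..
  next
    assume "u2 = [x]"
    then have "dec_subseq w {y\<in>S. x < y} (length u1)" "x \<in> S" "n = Suc (length u1)"
      using u * by (auto simp: dec_subseq_def sorted_wrt_append)
    then show ?R by blast
  qed
next
  assume ?R
  then show ?L
  proof
    assume "dec_subseq w S n"
    then show ?L unfolding dec_subseq_def using subseq_rev_drop_many by blast
  next
    assume "x \<in> S \<and> (\<exists>m. n = Suc m \<and> dec_subseq w {y\<in>S. x < y} m)"
    then obtain u where u: "x \<in> S" "n = Suc (length u)" "subseq u w" "sorted_wrt (>) u"
        "set u \<subseteq> {y\<in>S. x < y}"
      by (auto simp: dec_subseq_def)
    then have "subseq (u @ [x]) (w @ [x])" "sorted_wrt (>) (u @ [x])"
      by (auto simp: sorted_wrt_append)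
    then show ?L using u unfolding dec_subseq_def by (intro exI[of _ "u @ [x]"]) auto
  qed
qed

section \<open>Heights of the letters of a word\<close>

lemma N_tableau_of_snoc: "N_tableau_of (w @ [x]) = N_insert x (N_tableau_of w)"
  by (simp add: N_tableau_of_def)

lemma nested_rows_N_tableau_of: "nested_rows (N_tableau_of w)"
proof (induction w rule: rev_induct)
  case Nil
  show ?case by (simp add: N_tableau_of_def nested_rows_def)
qed (simp add: N_tableau_of_snoc nested_rows_N_insert)

lemma Union_N_tableau_of: "\<Union>(set (N_tableau_of w)) = set w"
proof (induction w rule: rev_induct)
  case (snoc x w)
  have "\<Union>(set (N_insert x (N_tableau_of w))) = insert x (\<Union>(set (N_tableau_of w)))"
    using nested_rows_finite[OF nested_rows_N_tableau_of] by (rule Union_N_insert)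
  then show ?case
    unfolding N_tableau_of_snoc snoc.IH by simp
qed (simp add: N_tableau_of_def)

definition height :: "'a::linorder list \<Rightarrow> 'a \<Rightarrow> nat" where
  "height w = row_count (N_tableau_of w)"

lemma height_eq_0_iff: "height w z = 0 \<longleftrightarrow> z \<notin> set w"
  by (simp only: height_def row_count_eq_0_iff Union_N_tableau_of)

lemma height_snoc:
  assumes "sorted_wrt (<) (us @ x # vs)" "set w \<subseteq> set (us @ x # vs)"
  shows "height (w @ [x]) = insert_height x vs (height w)"
  unfolding height_def N_tableau_of_snoc
proof (rule row_count_N_insert)
  show "y \<in> set vs" if "y \<in> \<Union>(set (N_tableau_of w))" "x < y" for y
  proof -
    have "y \<in> set (us @ x # vs)" "y \<notin> set us" "y \<noteq> x"
      using that assms unfolding Union_N_tableau_of sorted_wrt_append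
      by (auto dest: order.asym)
    then show ?thesis by simp
  qed
  show "sorted_wrt (<) (x # vs)"
    using assms(1) by (simp add: sorted_wrt_append)
qed (rule nested_rows_N_tableau_of)

section \<open>The walk defining e(R) and the map Delta in terms of heights\<close>

text \<open>
  With \<open>zs\<close> the increasing list of the letters above the minimum, \<open>stop_level f 1 zs\<close> is \<open>e(R)\<close> and
  \<open>shift_down f 1 zs\<close> the height function of \<open>\<Delta>(R)\<close>: the walk defining \<open>e(R)\<close> stands at the minimum of
  block \<open>n\<close> and stops as soon as a further letter of that block precedes the minimum of block \<open>n + 1\<close>.
\<close>

primrec stop_level :: "('a \<Rightarrow> nat) \<Rightarrow> nat \<Rightarrow> 'a list \<Rightarrow> nat" where
  "stop_level f n [] = n"
| "stop_level f n (z # zs) =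
     (if n < f z then stop_level f (Suc n) zs else if f z = n then n else stop_level f n zs)"

primrec shift_down :: "('a \<Rightarrow> nat) \<Rightarrow> nat \<Rightarrow> 'a list \<Rightarrow> 'a \<Rightarrow> nat" where
  "shift_down f n [] = f"
| "shift_down f n (z # zs) =
     (if n < f z then (shift_down f (Suc n) zs)(z := n)
      else if f z = n then f else shift_down f n zs)"

lemma stop_level_ge: "n \<le> stop_level f n zs"
  by (induction zs arbitrary: n) (auto intro: Suc_leD)

lemma stop_level_le_climb: "stop_level f n zs \<le> climb f n zs"
  by (induction zs arbitrary: n) (auto intro: climb_ge)

text \<open>Until they meet, the counter started at \<open>Suc n\<close> is the level of the walk
  and the other one is one less. They meet at a letter whose height is the current level, which is
  exactly where the walk stops.\<close>

lemma climb_less_stop_level_iff: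
  assumes "growth f (Suc n) (us @ vs)"
  shows "climb f n us < stop_level f (Suc n) (us @ vs) \<longleftrightarrow> climb f n us < climb f (Suc n) us"
  using assms
proof (induction us arbitrary: n)
  case Nil
  show ?case using stop_level_ge[of "Suc n" f vs] by simp
next
  case (Cons z us)
  consider "Suc n < f z" | "f z = Suc n" | "f z \<le> n" by linarith
  then show ?case
  proof cases
    case 2
    then show ?thesis using climb_ge[of "Suc n" f us] by simp
  qed (use Cons in auto)
qed

lemma shift_down_notin: "z \<notin> set zs \<Longrightarrow> shift_down f n zs z = f z"
  by (induction zs arbitrary: n) auto

lemma shift_down_pos: "0 < f z \<Longrightarrow> 0 < n \<Longrightarrow> 0 < shift_down f n zs z"
  by (induction zs arbitrary: n) auto

text \<open>A lowered letter goes from \<open>Suc n\<close> to \<open>n\<close>, and both exceed a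
  counter \<open>k < n\<close>, so it counts before and after. The gap persists until the walk
  stops; from there on heights are unchanged.\<close>

lemma climb_shift_down_prefix:
  assumes "growth f n (us @ vs)" "distinct (us @ vs)" "k < n"
  shows "climb (shift_down f n (us @ vs)) k us = climb f k us"
  using assms
proof (induction us arbitrary: n k)
  case (Cons z us)
  consider "n < f z" | "f z = n" | "f z < n" by linarith
  then show ?case
  proof cases
    case 1
    then have "f z = Suc n" using Cons.prems by simp
    then have "climb (shift_down f n ((z # us) @ vs)) k (z # us)
        = climb ((shift_down f (Suc n) (us @ vs))(z := n)) (Suc k) us"
      using Cons.prems(3) by simp
    also have "\<dots> = climb (shift_down f (Suc n) (us @ vs)) (Suc k) us"
      using Cons.prems(2) by (intro climb_cong) auto
    also have "\<dots> = climb f (Suc k) us"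
      using Cons.prems 1 by (intro Cons.IH) auto
    also have "\<dots> = climb f k (z # us)"
      using 1 Cons.prems(3) by simp
    finally show ?thesis .
  next
    case 3
    then have "shift_down f n ((z # us) @ vs) z = f z"
      using Cons.prems(2) by (simp add: shift_down_notin)
    moreover have "climb (shift_down f n (us @ vs)) (if k < f z then Suc k else k) us
        = climb f (if k < f z then Suc k else k) us"
      using Cons.prems 3 by (intro Cons.IH) auto
    ultimately show ?thesis using 3 by simp
  qed simp
qed simp

text \<open>Along \<open>us\<close> the level of the walk only rises, so unless the walk has stopped
  it enters \<open>vs\<close> at a positive level, above the start 0 of the counter.\<close>

lemma climb_shift_down:
  assumes "growth f (Suc n) (us @ vs @ ts)" "distinct (us @ vs @ ts)"
  shows "climb (shift_down f (Suc n) (us @ vs @ ts)) 0 vs = climb f 0 vs"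
  using assms
proof (induction us arbitrary: n)
  case Nil
  then show ?case by (simp add: climb_shift_down_prefix)
next
  case (Cons z us)
  have "climb (g(z := c)) 0 vs = climb g 0 vs" for g and c :: nat
    using Cons.prems(2) by (intro climb_cong) auto
  with Cons show ?case by (auto simp: less_Suc_eq)
qed

text \<open>The counter of the lowered heights stays one below the level of the walk and catches up
  where the walk stops; hence the start \<open>n\<close>.\<close>

lemma growth_shift_down:
  assumes "growth f (Suc n) zs" "distinct zs"
  shows "growth (shift_down f (Suc n) zs) n zs"
  using assms
proof (induction zs arbitrary: n)
  case (Cons z zs)
  consider "Suc n < f z" | "f z = Suc n" | "f z \<le> n" by linarith
  then show ?case
  proof cases
    case 1
    then have "growth (shift_down f (Suc n) (z # zs)) (Suc n) zs
        = growth (shift_down f (Suc (Suc n)) zs) (Suc n) zs"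
      using Cons.prems(2) by (intro growth_cong) auto
    then have "growth (shift_down f (Suc n) (z # zs)) (Suc n) zs"
      using Cons 1 by simp
    moreover have "shift_down f (Suc n) (z # zs) z = Suc n"
      using 1 by simp
    ultimately show ?thesis by (simp del: shift_down.simps)
  next
    case 2
    then show ?thesis using Cons.prems by simp
  next
    case 3
    then show ?thesis using Cons by (simp add: shift_down_notin)
  qed
qed simp

text \<open>Closed form for the comparison with \<open>Delta_block\<close>: the walk lowers a letter
  when it meets it as the first of its height, and it gets as far as the stop level.\<close>

lemma shift_down_eq:
  fixes zs :: "'a::linorder list"
  assumes "growth f n zs" "sorted_wrt (<) zs"
  shows "shift_down f n zs z =
    (if z \<in> set zs \<and> n < f z \<and> f z \<le> stop_level f n zs \<and> (\<forall>y\<in>set zs. f y = f z \<longrightarrow> z \<le> y)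
     then f z - 1 else f z)"
  using assms
proof (induction zs arbitrary: n)
  case (Cons x zs)
  consider "n < f x" | "f x = n" | "f x < n" by linarith
  then show ?case
  proof cases
    case 1
    then have fx: "f x = Suc n" and g: "growth f (Suc n) zs" using Cons.prems by simp_all
    show ?thesis
    proof (cases "z = x")
      case True
      then show ?thesis
        using 1 fx Cons.prems(2) stop_level_ge[of "Suc n" f zs] by auto
    next
      case False
      then show ?thesis
        using 1 fx Cons.IH[OF g] Cons.prems(2) by auto
    qed
  next
    case 2
    then show ?thesis by auto
  next
    case 3
    then have g: "growth f n zs" using Cons.prems by simp
    show ?thesis
      using 3 Cons.IH[OF g] Cons.prems(2) by auto
  qed
qed simp

section \<open>Set partitions given by heights\<close>

text \<open>Indexing by the heights that occur keeps the empty set out.\<close>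

definition level_sets :: "('a \<Rightarrow> nat) \<Rightarrow> 'a set \<Rightarrow> 'a set set" where
  "level_sets f S = (\<lambda>i. {z\<in>S. f z = i}) ` f ` S"

lemma Union_level_sets: "\<Union>(level_sets f S) = S"
  by (auto simp: level_sets_def)

lemma finite_partition_level_sets: "finite S \<Longrightarrow> finite_partition (level_sets f S)"
  unfolding finite_partition_def partition_on_def Union_level_sets
  by (auto simp: level_sets_def disjoint_def)

text \<open>The two cases are those of \<open>evac\<close>: the new letter joins an existing block
  or forms a block of its own.\<close>

lemma level_sets_insert:
  fixes f :: "'a \<Rightarrow> nat"
  assumes "t \<notin> S"
  defines "C \<equiv> {z\<in>S. f z = f t}"
  shows "level_sets f (insert t S) =
    (if f t \<in> f ` S then insert (insert t C) (level_sets f S - {C}) else insert {t} (level_sets f S))"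
proof -
  let ?rest = "(\<lambda>i. {z\<in>S. f z = i}) ` (f ` S - {f t})"
  have "level_sets f (insert t S) = insert (insert t C) ((\<lambda>i. {z\<in>insert t S. f z = i}) ` (f ` S - {f t}))"
    unfolding level_sets_def C_def by auto
  also have "(\<lambda>i. {z\<in>insert t S. f z = i}) ` (f ` S - {f t}) = ?rest"
    by (intro image_cong) auto
  finally have 1: "level_sets f (insert t S) = insert (insert t C) ?rest" .
  show ?thesis
  proof (cases "f t \<in> f ` S")
    case True
    have "level_sets f S - {C} = ?rest"
      unfolding level_sets_def C_def using True by auto
    then show ?thesis using 1 True by simp
  next
    case False
    then have "C = {}"
      unfolding C_def by (metis (mono_tags, lifting) Collect_empty_eq image_eqI)
    then show ?thesis using 1 False by (simp add: level_sets_def)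
  qed
qed

section \<open>Blocks, walk and Delta for the partition of a height function\<close>

text \<open>Growth and positivity make the heights an initial segment of the positive integers whose
  first occurrences are in order. Thus the letters of height \<open>i\<close> form the
  \<open>i\<close>-th block.\<close>

locale height_word =
  fixes f :: "'a::linorder \<Rightarrow> nat" and as :: "'a list"
  assumes sorted: "sorted_wrt (<) as"
    and growth: "growth f 0 as"
    and pos: "z \<in> set as \<Longrightarrow> 0 < f z"
begin

abbreviation "k \<equiv> climb f 0 as"
abbreviation "R \<equiv> level_sets f (set as)"

definition level :: "nat \<Rightarrow> 'a set" where "level i = {z\<in>set as. f z = i}"

lemma distinct: "distinct as"
  using sorted by (simp add: strict_sorted_iff)

lemma image_eq: "f ` set as = {1..k}"
proof
  show "f ` set as \<subseteq> {1..k}"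
    using growth_le_climb[OF growth] pos by (auto simp: Suc_le_eq)
  show "{1..k} \<subseteq> f ` set as"
  proof
    fix i assume "i \<in> {1..k}"
    then have "\<exists>z\<in>set as. f z = i" by (intro growth_attained[OF growth]) auto
    then show "i \<in> f ` set as" by blast
  qed
qed

lemma R_eq: "R = level ` {1..k}"
  by (simp add: level_sets_def image_eq level_def)

lemma level_iff: "z \<in> level i \<longleftrightarrow> z \<in> set as \<and> f z = i"
  by (simp add: level_def)

lemma finite_level [simp]: "finite (level i)"
  by (simp add: level_def)

lemma level_nonempty: "i \<in> {1..k} \<Longrightarrow> level i \<noteq> {}"
  unfolding image_eq[symmetric] level_def by auto

lemma Min_level: "i \<in> {1..k} \<Longrightarrow> Min (level i) \<in> level i"
  by (simp only: Min_in finite_level level_nonempty simp_thms)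

lemma Min_level_less:
  assumes "1 \<le> i" "i < j" "j \<le> k"
  shows "Min (level i) < Min (level j)"
proof -
  have "Min (level j) \<in> level j" using assms by (intro Min_level) auto
  then obtain y where "y \<in> set as" "y < Min (level j)" "f y = i"
    using growth_attained_before[OF growth sorted, of "Min (level j)" i] assms
    by (auto simp: level_def)
  moreover from this have "Min (level i) \<le> y"
    by (intro Min_le) (auto simp: level_def)
  ultimately show ?thesis by order
qed

lemma finite_partition_R: "finite_partition R"
  by (simp add: finite_partition_level_sets)

text \<open>Both lists contain the same blocks with strictly increasing minima, and
  \<open>Min\<close> is injective on the blocks.\<close>

lemma blocks_eq: "blocks R = map level [1..<Suc k]"
proof -
  let ?L = "map level [1..<Suc k]"
  have set: "set ?L = R" by (simp add: R_eq atLeastLessThanSuc_atLeastAtMost del: upt_Suc)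
  have sorted: "sorted_wrt (<) (map Min ?L)"
    unfolding sorted_wrt_iff_nth_less by (auto intro!: Min_level_less simp del: upt_Suc)
  note blocks = finite_partition_blocks(1,3)[OF finite_partition_R]
  have "map Min ?L = map Min (blocks R)"
  proof (rule strict_sorted_equal)
    show "set (map Min ?L) = set (map Min (blocks R))"
      using set blocks(1) by (metis set_map)
  qed (fact sorted blocks)+
  moreover have "inj_on Min (set ?L \<union> set (blocks R))"
    using sorted unfolding set blocks(1) strict_sorted_iff distinct_map[of Min] by (simp add: set)
  ultimately have "?L = blocks R" by (rule map_inj_on)
  then show ?thesis ..
qed

lemma card_R: "card R = k"
  using finite_partition_blocks(2)[OF finite_partition_R] by (simp add: blocks_eq del: upt_Suc)

lemma block_eq: "j \<in> {1..k} \<Longrightarrow> block R j = level j"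
  by (auto simp: block_def blocks_eq simp del: upt_Suc)

lemma block_min_eq: "j \<in> {1..k} \<Longrightarrow> block_min R j = Min (level j)"
  by (simp add: block_min_def block_eq)

text \<open>For \<open>n\<close> from 1 to \<open>k\<close>, this is the part of
  \<open>block_word R\<close> to the right of the minimum of block \<open>n\<close>.\<close>

definition rest_word :: "nat \<Rightarrow> 'a list" where
  "rest_word n = sorted_list_of_set (level n - {Min (level n)})
     @ concat (map sorted_list_of_set (map level [Suc n..<Suc k]))"

lemma sorted_list_of_level:
  assumes "i \<in> {1..k}"
  shows "sorted_list_of_set (level i) = Min (level i) # sorted_list_of_set (level i - {Min (level i)})"
  using assms by (simp only: sorted_list_of_set_nonempty finite_level level_nonempty not_False_eq_True)

lemma right_of_append:
  "z \<notin> set xs \<Longrightarrow> right_of z (xs @ z # ys) = ys"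
  by (induction xs) (auto simp: right_of_def)

lemma right_of_rest_word:
  assumes "1 \<le> n" "n < k"
  shows "right_of (Min (level (Suc n))) (rest_word n) = rest_word (Suc n)"
proof -
  have "Min (level (Suc n)) \<in> level (Suc n)" using assms by (intro Min_level) auto
  then have notin: "Min (level (Suc n)) \<notin> set (sorted_list_of_set (level n - {Min (level n)}))"
    by (simp add: level_def)
  have "[Suc n..<Suc k] = Suc n # [Suc (Suc n)..<Suc k]"
    using assms(2) by (intro upt_conv_Cons) simp
  then have "rest_word n = sorted_list_of_set (level n - {Min (level n)})
      @ Min (level (Suc n)) # rest_word (Suc n)"
    using sorted_list_of_level[of "Suc n"] assms by (simp add: rest_word_def del: upt_Suc)
  then show ?thesis
    using right_of_append[OF notin] by simp
qed

text \<open>\<open>p\<close> holds the letters scanned so far. None is higher than \<open>n\<close>,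
  and the only one of height \<open>n\<close> is the current letter of the walk, so whatever lies to
  its right in the block word is still in \<open>zs\<close>.\<close>

lemma set_rest_word:
  assumes "as = p @ zs" "n = climb f 0 p" "1 \<le> n" "{z\<in>set p. f z = n} = {Min (level n)}"
  shows "set (rest_word n) = {z\<in>set zs. n \<le> f z}"
proof -
  have p: "\<not> n < f z" if "z \<in> set p" for z
    using growth_le_climb[of f 0 p z] growth that assms by (simp add: growth_append)
  have disj: "z \<notin> set zs" if "z \<in> set p" for z
    using distinct assms(1) that by auto
  have as: "set as = set p \<union> set zs" using assms(1) by simp
  have "Min (level n) \<in> set p" using assms(4) by blast
  then have 1: "level n - {Min (level n)} = {z\<in>set zs. f z = n}"
    using assms(4) disj by (auto simp: level_iff as)
  have "set (rest_word n) = (level n - {Min (level n)}) \<union> (\<Union>i\<in>{Suc n..k}. level i)"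
    by (auto simp: rest_word_def atLeastLessThanSuc_atLeastAtMost simp del: upt_Suc)
  also have "(\<Union>i\<in>{Suc n..k}. level i) = {z\<in>set zs. n < f z}"
  proof (intro set_eqI iffI)
    fix z assume "z \<in> (\<Union>i\<in>{Suc n..k}. level i)"
    then have "z \<in> set as" "n < f z" by (auto simp: level_iff)
    then show "z \<in> {z\<in>set zs. n < f z}" using p[of z] as by auto
  next
    fix z assume "z \<in> {z\<in>set zs. n < f z}"
    then have "z \<in> level (f z)" "f z \<in> {Suc n..k}"
      using growth_le_climb[OF growth, of z] by (simp_all add: level_iff as)
    then show "z \<in> (\<Union>i\<in>{Suc n..k}. level i)" by blast
  qed
  finally show ?thesis unfolding 1 by (auto simp: le_less)
qed

text \<open>\<open>stop_level\<close> scans the alphabet upwards, whereas \<open>e_walk\<close>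
  jumps to the least letter on the right. A scanned letter of height below \<open>n\<close> lies to
  the left and is ignored; one of height \<open>n\<close> is that least letter but no block minimum;
  a higher one is the minimum of block \<open>n + 1\<close>.\<close>

lemma e_walk_eq:
  assumes "as = p @ zs" "n = climb f 0 p" "1 \<le> n" "{z\<in>set p. f z = n} = {Min (level n)}"
  shows "e_walk R (rest_word n) n = stop_level f n zs"
  using assms
proof (induction zs arbitrary: p n)
  case Nil
  then have "rest_word n = []" using set_rest_word[OF Nil] by simp
  then show ?case by (subst e_walk.simps) simp
next
  case (Cons z zs)
  note set = set_rest_word[OF Cons.prems]
  have as: "set as = set p \<union> insert z (set zs)" using Cons.prems(1) by simp
  have "z \<notin> set p" "\<And>y. y \<in> set zs \<Longrightarrow> z < y"
    using sorted Cons.prems(1) by (auto simp: sorted_wrt_append)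
  have Min: "Min (set (rest_word n)) = z" if "n \<le> f z"
    using that \<open>\<And>y. y \<in> set zs \<Longrightarrow> z < y\<close> unfolding set
    by (intro Min_eqI) (auto intro: less_imp_le)
  have ne: "rest_word n \<noteq> []" if "n \<le> f z"
    using that set by (auto simp flip: set_empty)
  have index: "f (block_min R j) = j" if "j \<in> {1..card R}" for j
    using that Min_level[of j] by (simp add: card_R block_min_eq level_def)
  have step: "growth f n (z # zs)"
    using growth Cons.prems(1,2) by (simp add: growth_append)
  consider "n < f z" | "f z = n" | "f z < n" by linarith
  then show ?case
  proof cases
    case 3
    then have "e_walk R (rest_word n) n = stop_level f n zs"
    proof (intro Cons.IH[of "p @ [z]"])
      show "n = climb f 0 (p @ [z])" using 3 Cons.prems(2) by (simp add: climb_append)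
      have "{y \<in> set (p @ [z]). f y = n} = {y\<in>set p. f y = n}" using 3 by auto
      then show "{y \<in> set (p @ [z]). f y = n} = {Min (level n)}" using Cons.prems(4) by simp
    qed (use Cons.prems(1,3) in simp_all)
    then show ?thesis using 3 by simp
  next
    case 2
    have "block_min R j \<noteq> z" if "j \<in> {1..card R}" for j
    proof
      assume "block_min R j = z"
      moreover from this have "j = n" using index[OF that] 2 by simp
      ultimately have "z \<in> set p"
        using that Cons.prems(4) by (auto simp: block_min_eq card_R)
      then show False using \<open>z \<notin> set p\<close> by simp
    qed
    then have "e_walk R (rest_word n) n = n"
      using Min 2 by (subst e_walk.simps) auto
    then show ?thesis using 2 by simp
  next
    case 1
    then have fz: "f z = Suc n" using step by simp
    have nk: "Suc n \<in> {1..k}"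
      using image_eq fz as by (metis UnCI imageI insertI1)
    have p: "f y \<le> n" if "y \<in> set p" for y
      using growth_le_climb[of f 0 p y] growth that Cons.prems by (simp add: growth_append)
    have z: "z = Min (level (Suc n))"
    proof (rule Min_eqI[symmetric])
      show "z \<le> y" if "y \<in> level (Suc n)" for y
      proof -
        have "y \<notin> set p" using p[of y] that by (auto simp: level_iff)
        then show ?thesis
          using that \<open>\<And>y. y \<in> set zs \<Longrightarrow> z < y\<close>
          by (auto simp: level_iff as intro: less_imp_le)
      qed
    qed (use fz as in \<open>auto simp: level_iff\<close>)
    have bm: "block_min R (Suc n) = z" using nk z block_min_eq by metis
    have the: "(THE j. j \<in> {1..card R} \<and> block_min R j = z) = Suc n"
    proof (rule the_equality)
      show "Suc n \<in> {1..card R} \<and> block_min R (Suc n) = z"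
        using nk bm card_R by simp
      show "j = Suc n" if "j \<in> {1..card R} \<and> block_min R j = z" for j
        using index[of j] that fz by simp
    qed
    have ex: "\<exists>j\<in>{1..card R}. block_min R j = z"
      using nk bm card_R by metis
    have "right_of z (rest_word n) = rest_word (Suc n)"
      using right_of_rest_word[of n] Cons.prems(3) nk z by simp
    then have "e_walk R (rest_word n) n = e_walk R (rest_word (Suc n)) (Suc n)"
      using Min ne 1 ex the by (subst e_walk.simps) simp
    also have "\<dots> = stop_level f (Suc n) zs"
    proof (rule Cons.IH[of "p @ [z]"])
      show "{y \<in> set (p @ [z]). f y = Suc n} = {Min (level (Suc n))}"
        using p fz unfolding z[symmetric] by force
      show "Suc n = climb f 0 (p @ [z])" using 1 Cons.prems(2) by (simp add: climb_append)
    qed (use Cons.prems(1) in simp_all)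
    finally show ?thesis using 1 by simp
  qed
qed

lemma level_1:
  assumes "as = b # bs"
  shows "f b = 1" "Min (level (Suc 0)) = b" "k = climb f (Suc 0) bs"
proof -
  show fb: "f b = 1" using growth pos[of b] assms by simp
  then show "k = climb f (Suc 0) bs" using assms by simp
  have as: "set as = insert b (set bs)" "\<forall>y\<in>set bs. b < y" using sorted assms by simp_all
  then show "Min (level (Suc 0)) = b"
    using fb by (intro Min_eqI) (auto simp: level_iff intro: less_imp_le)
qed

lemma e_index_eq:
  assumes as: "as = b # bs"
  shows "e_index R = stop_level f (Suc 0) bs"
proof -
  have k: "1 \<le> k" using level_1(3)[OF as] climb_ge[of "Suc 0" f bs] by simp
  then have "[1..<Suc k] = 1 # [Suc 1..<Suc k]" by (intro upt_conv_Cons) simp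
  then have "block_word R = b # rest_word (Suc 0)"
    using sorted_list_of_level[of 1] level_1(2)[OF as] k
    by (simp add: block_word_def blocks_eq rest_word_def del: upt_Suc)
  moreover have "block_min R 1 = b" using block_min_eq[of 1] k level_1(2)[OF as] by simp
  ultimately have "e_index R = e_walk R (rest_word (Suc 0)) (Suc 0)"
    by (simp add: e_index_def right_of_def)
  also have "\<dots> = stop_level f (Suc 0) bs"
    using as level_1[OF as] by (intro e_walk_eq[of "[b]"]) auto
  finally show ?thesis .
qed

lemma Delta_eq:
  assumes as: "as = b # bs"
  shows "Delta R = level_sets (shift_down f (Suc 0) bs) (set bs)"
proof -
  let ?g = "shift_down f (Suc 0) bs" and ?e = "stop_level f (Suc 0) bs"
  have set_as: "set as = insert b (set bs)" using as by simp
  have k: "k = climb f (Suc 0) bs" and b: "f b = 1" "Min (level (Suc 0)) = b"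
    using level_1[OF as] by blast+
  have e: "1 \<le> ?e" "?e \<le> k"
    using stop_level_ge[of "Suc 0" f bs] stop_level_le_climb[of f "Suc 0" bs] k by auto
  have gr: "growth f (Suc 0) bs" and sb: "sorted_wrt (<) bs" and bbs: "y \<in> set bs \<Longrightarrow> b < y" for y
    using growth sorted b(1) unfolding as by simp_all
  have fz: "1 \<le> f z" "f z \<le> k" if "z \<in> set as" for z
    using that image_eq by auto
  \<comment> \<open>This would fail for the first letter of height 1 in \<open>bs\<close>, as the
    minimum of block 1 is \<open>b\<close>.\<close>
  have first: "(\<forall>y\<in>set bs. f y = f z \<longrightarrow> z \<le> y) \<longleftrightarrow> z = Min (level (f z))"
    if "z \<in> set bs" "1 < f z" for z
  proof -
    have "level (f z) = {y\<in>set bs. f y = f z}" using that(2) b by (auto simp: level_iff set_as)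
    then show ?thesis
      using that by (subst eq_commute, subst Min_eq_iff) auto
  qed
  have g: "?g z = (if 1 < f z \<and> f z \<le> ?e \<and> z = Min (level (f z)) then f z - 1 else f z)"
    if "z \<in> set bs" for z
    using shift_down_eq[OF gr sb, of z] first[of z] that by auto
  have Min_level': "Min (level j) \<in> set bs" "f (Min (level j)) = j" if "1 < j" "j \<le> k" for j
    using Min_level[of j] that b by (auto simp: level_iff set_as)
  have Delta_block: "Delta_block R j = {z\<in>set bs. ?g z = j}" if j: "j \<in> {1..k}" for j
  proof -
    consider "j < ?e" | "j = ?e" | "j > ?e" by linarith
    then show ?thesis
    proof cases
      case 1
      then have "Delta_block R j = (level j - {Min (level j)}) \<union> {Min (level (Suc j))}"
        using j e by (simp add: Delta_block_def e_index_eq[OF as] block_eq block_min_eq)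
      also have "\<dots> = {z\<in>set bs. ?g z = j}"
      proof (intro set_eqI iffI)
        fix z assume z: "z \<in> (level j - {Min (level j)}) \<union> {Min (level (Suc j))}"
        then show "z \<in> {z\<in>set bs. ?g z = j}"
        proof
          assume "z \<in> level j - {Min (level j)}"
          then have "z \<in> set bs" "f z = j" "z \<noteq> Min (level j)" using b by (auto simp: level_iff set_as)
          then show ?thesis by (simp add: g)
        next
          assume "z \<in> {Min (level (Suc j))}"
          then have "z \<in> set bs" "f z = Suc j" "z = Min (level (Suc j))"
            using Min_level'[of "Suc j"] 1 j e by auto
          then show ?thesis using 1 j by (simp add: g)
        qed
      next
        fix z assume "z \<in> {z\<in>set bs. ?g z = j}"
        then have z: "z \<in> set bs" "?g z = j" by auto
        show "z \<in> (level j - {Min (level j)}) \<union> {Min (level (Suc j))}"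
        proof (cases "1 < f z \<and> f z \<le> ?e \<and> z = Min (level (f z))")
          case True
          then have "f z = Suc j" using z g by auto
          then show ?thesis using True by auto
        next
          case False
          then have "f z = j" using z g by auto
          \<comment> \<open>For \<open>j = 1\<close> this minimum is \<open>b\<close>, which is not
            in \<open>bs\<close>; for larger \<open>j\<close> below the stop level it would have
            been lowered.\<close>
          moreover have "z \<noteq> Min (level j)"
          proof
            assume "z = Min (level j)"
            moreover from this have "j \<noteq> 1" using b(2) bbs[OF z(1)] by auto
            ultimately show False using False \<open>f z = j\<close> 1 j by auto
          qed
          ultimately show ?thesis using z by (auto simp: level_iff set_as)
        qed
      qed
      finally show ?thesis .
    next
      case 2
      then have "Delta_block R j = level j - {Min (level j)}"
        using j e by (simp add: Delta_block_def e_index_eq[OF as] block_eq block_min_eq)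
      also have "\<dots> = {z\<in>set bs. ?g z = j}"
      proof (intro set_eqI iffI)
        fix z assume "z \<in> level j - {Min (level j)}"
        then have "z \<in> set bs" "f z = j" "z \<noteq> Min (level j)" using b by (auto simp: level_iff set_as)
        then show "z \<in> {z\<in>set bs. ?g z = j}" by (simp add: g)
      next
        fix z assume "z \<in> {z\<in>set bs. ?g z = j}"
        then have z: "z \<in> set bs" "?g z = j" by auto
        have not: "\<not> (1 < f z \<and> f z \<le> ?e \<and> z = Min (level (f z)))"
        proof
          assume "1 < f z \<and> f z \<le> ?e \<and> z = Min (level (f z))"
          then show False using z g[OF z(1)] 2 by auto
        qed
        then have fz: "f z = j" using z g[OF z(1)] by argo
        moreover have "z \<noteq> Min (level j)"
        proof
          assume "z = Min (level j)"
          moreover from this have "j \<noteq> 1" using b(2) bbs[OF z(1)] by auto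
          ultimately show False using not fz 2 j by auto
        qed
        ultimately show "z \<in> level j - {Min (level j)}" using z by (auto simp: level_iff set_as)
      qed
      finally show ?thesis .
    next
      case 3
      then have "Delta_block R j = level j"
        using j by (simp add: Delta_block_def e_index_eq[OF as] block_eq)
      also have "\<dots> = {z\<in>set bs. ?g z = j}"
      proof (intro set_eqI iffI)
        fix z assume "z \<in> level j"
        then have "z \<in> set bs" "f z = j" using b 3 e by (auto simp: level_iff set_as)
        then show "z \<in> {z\<in>set bs. ?g z = j}" using 3 by (simp add: g)
      next
        fix z assume "z \<in> {z\<in>set bs. ?g z = j}"
        then have z: "z \<in> set bs" "?g z = j" by auto
        then have "f z = j" using g[OF z(1)] 3 by (auto split: if_splits)
        then show "z \<in> level j" using z by (simp add: level_iff set_as)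
      qed
      finally show ?thesis .
    qed
  qed
  have image: "?g ` set bs \<subseteq> {1..k}"
  proof
    fix i assume "i \<in> ?g ` set bs"
    then obtain z where "z \<in> set bs" "i = ?g z" by blast
    then show "i \<in> {1..k}" using g[of z] fz[of z] set_as by (auto split: if_splits)
  qed
  have "Delta R = (\<lambda>j. {z\<in>set bs. ?g z = j}) ` {1..k} - {{}}"
    unfolding Delta_def card_R using Delta_block by (metis (no_types, lifting) image_cong)
  \<comment> \<open>Removing the empty set leaves exactly the levels that still occur.\<close>
  also have "\<dots> = level_sets ?g (set bs)"
    using image unfolding level_sets_def by auto
  finally show ?thesis .
qed

end

section \<open>Evacuation in terms of heights\<close>

lemma evac_step:
  fixes A :: "'a::linorder set"
  assumes "R \<noteq> {}" "finite_partition R"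
  defines "S \<equiv> evac A (Delta R)" and "e \<equiv> e_index R" and "t \<equiv> order_reversal A (Min (\<Union>R))"
  shows "evac A R = (if card S < e then insert {t} S
      else insert (insert t (block S e)) (S - {block S e}))"
  using assms(1,2) unfolding S_def e_def t_def by (subst evac.simps) (simp add: Let_def)

text \<open>\<open>g\<close> stays fixed in the induction: removing the least letter
  \<open>b\<close> removes only the last letter of \<open>bs\<close>, whereas \<open>f\<close>
  passes to the heights of Delta. The hypothesis on intervals \<open>vs\<close> is inherited because
  Delta preserves the counters of intervals that avoid \<open>b\<close>.\<close>

lemma evac_level_sets:
  assumes "height_word f as" "height_word g bs" "bs = rev (map (order_reversal A) as)"
    and "\<And>us vs ts. as = us @ vs @ ts \<Longrightarrow> climb f 0 vs = climb g 0 (rev (map (order_reversal A) vs))"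
  shows "level_sets g (set bs) = evac A (level_sets f (set as))"
  using assms
proof (induction as arbitrary: f bs)
  case Nil
  then show ?case by (subst evac.simps) (simp add: level_sets_def)
next
  case (Cons b as)
  let ?rev = "\<lambda>vs. rev (map (order_reversal A) vs)" and ?t = "order_reversal A b"
  let ?cs = "?rev as" and ?f = "shift_down f (Suc 0) as" and ?e = "stop_level f (Suc 0) as"
  let ?R = "level_sets f (set (b # as))" and ?S = "level_sets g (set ?cs)"
  interpret f: height_word f "b # as" by fact
  interpret g: height_word g bs by fact
  have fb: "f b = 1" using f.level_1 by blast
  have bs: "bs = ?cs @ [?t]" using Cons.prems(3) by simp
  have gf: "growth f (Suc 0) as" using f.growth fb by simp
  \<comment> \<open>The intervals without and with \<open>b\<close>; as \<open>b\<close> has height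
    1, including it means starting the counter at 1.\<close>
  have dual: "climb f 0 us = climb g 0 (?rev us)" "climb f (Suc 0) us = climb g 0 (?rev us @ [?t])"
    if "as = us @ vs" for us vs
    using Cons.prems(4)[of "[b]" us vs] Cons.prems(4)[of "[]" "b # us" vs] that fb by auto
  have hcs: "height_word g ?cs"
    using g.sorted g.growth g.pos unfolding bs
    by unfold_locales (auto simp: sorted_wrt_append growth_append)
  have S: "?S = evac A (level_sets ?f (set as))"
  proof (rule Cons.IH[OF _ hcs refl])
    show "height_word ?f as"
    proof
      show "growth ?f 0 as"
        using growth_shift_down[of f 0 as] gf f.distinct by simp
    qed (use f.sorted f.pos in \<open>auto intro: shift_down_pos\<close>)
    show "climb ?f 0 vs = climb g 0 (?rev vs)" if "as = us @ vs @ ts" for us vs ts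
      using Cons.prems(4)[of "b # us" vs ts] climb_shift_down[of f 0 us vs ts] that gf f.distinct
      by simp
  qed
  \<comment> \<open>Both inequalities say that adding \<open>b\<close> raises the counter of
    \<open>us\<close>; on the side of \<open>g\<close> the added letter \<open>?t\<close> comes
    last.\<close>
  have less_iff: "climb f 0 us < g ?t \<longleftrightarrow> climb f 0 us < ?e" if "as = us @ vs" for us vs
    using climb_less_stop_level_iff[of f 0 us vs] gf dual[OF that] that
    by (auto simp: climb_append)
  have "g ?t = ?e"
  proof (rule ccontr)
    assume neq: "g ?t \<noteq> ?e"
    have "g ?t \<le> Suc (climb f 0 as)"
      using g.growth dual(1)[of as "[]"] unfolding bs by (simp add: growth_append)
    moreover have "?e \<le> Suc (climb f 0 as)"
      using stop_level_le_climb[of f "Suc 0" as] climb_Suc_le[of f 0 as] by simp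
    ultimately have "min (g ?t) ?e \<le> climb f 0 as" using neq by linarith
    \<comment> \<open>At an initial segment whose counter is the smaller of the two numbers, exactly
      one of the inequalities in \<open>less_iff\<close> holds.\<close>
    then obtain us vs where "as = us @ vs" "climb f 0 us = min (g ?t) ?e"
      using climb_prefix_attained by blast
    then show False using less_iff[of us vs] neq by linarith
  qed
  have e: "e_index ?R = ?e" using f.e_index_eq by blast
  have Delta: "Delta ?R = level_sets ?f (set as)" using f.Delta_eq by blast
  interpret cs: height_word g ?cs by fact
  have "?R \<noteq> {}" by (simp add: level_sets_def)
  have Min: "Min (\<Union>?R) = b"
    unfolding Union_level_sets using f.sorted by (intro Min_eqI) (auto intro: less_imp_le)
  have evac: "evac A ?R = (if card ?S < ?e then insert {?t} ?S
      else insert (insert ?t (block ?S ?e)) (?S - {block ?S ?e}))"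
    using evac_step[OF \<open>?R \<noteq> {}\<close> f.finite_partition_R, of A] unfolding e Delta Min S[symmetric] .
  have t: "?t \<notin> set ?cs" using g.distinct unfolding bs by simp
  have e1: "1 \<le> ?e" using stop_level_ge[of "Suc 0" f as] by simp
  have "set bs = insert ?t (set ?cs)" unfolding bs by simp
  then have "level_sets g (set bs) =
      (if ?e \<in> g ` set ?cs then insert (insert ?t {z\<in>set ?cs. g z = ?e}) (?S - {{z\<in>set ?cs. g z = ?e}})
       else insert {?t} ?S)"
    using level_sets_insert[OF t, of g] \<open>g ?t = ?e\<close> by simp
  \<comment> \<open>The heights on \<open>?cs\<close> run exactly from 1 to the number of blocks, so
    \<open>?e\<close> is among them iff \<open>card ?S < ?e\<close> fails.\<close>
  also have "\<dots> = evac A ?R"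
  proof (cases "?e \<le> cs.k")
    case True
    then have "block ?S ?e = {z\<in>set ?cs. g z = ?e}"
      using e1 cs.block_eq[of ?e] unfolding cs.level_def by simp
    then show ?thesis
      using e1 True unfolding evac cs.image_eq cs.card_R by simp
  next
    case False
    then show ?thesis
      unfolding evac cs.image_eq cs.card_R by simp
  qed
  finally show ?case .
qed

section \<open>Existence and uniqueness of the order-reversing permutation\<close>

text \<open>Existence: the letter with \<open>r\<close> letters of \<open>A\<close> below it goes to
  place \<open>card A - 1 - r\<close> of the sorted list. Uniqueness: any such map sends the
  increasing list of \<open>A\<close> to its reverse.\<close>

lemma order_reversal:
  assumes "finite A"
  shows "order_reversal A permutes A" "monotone_on A (<) (>) (order_reversal A)"
proof -
  let ?l = "sorted_list_of_set A" and ?P = "\<lambda>f. f permutes A \<and> monotone_on A (<) (>) f"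
  define rank where "rank x = card {y\<in>A. y < x}" for x
  define f where "f x = (if x \<in> A then ?l ! (card A - 1 - rank x) else x)" for x
  have l: "sorted_wrt (<) ?l" "set ?l = A" "length ?l = card A"
    using assms by auto
  have rank: "rank x < card A" if "x \<in> A" for x
    unfolding rank_def using assms that by (intro psubset_card_mono) auto
  have rank_less: "rank x < rank y" if "x \<in> A" "x < y" for x y
    unfolding rank_def using assms that
    by (intro psubset_card_mono psubsetI) (auto intro: less_trans)
  have mono: "monotone_on A (<) (>) f"
  proof (rule monotone_onI)
    fix x y assume xy: "x \<in> A" "y \<in> A" "x < y"
    then have "card A - 1 - rank y < card A - 1 - rank x"
      using rank[of x] rank[of y] rank_less[of x y] by linarith
    then show "f y < f x"
      using xy l rank[of x] sorted_wrt_nth_less[OF l(1)] by (simp add: f_def)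
  qed
  have "f ` A \<subseteq> A"
  proof (rule image_subsetI)
    fix x assume "x \<in> A"
    with rank[of x] have "card A - 1 - rank x < length ?l" using l(3) by linarith
    then have "?l ! (card A - 1 - rank x) \<in> set ?l" by (rule nth_mem)
    with \<open>x \<in> A\<close> show "f x \<in> A" unfolding l(2) by (simp add: f_def)
  qed
  moreover have "inj_on f A"
    by (rule linorder_inj_onI') (use mono in \<open>force simp: monotone_on_def\<close>)
  ultimately have "bij_betw f A A"
    using endo_inj_surj[OF assms] by (simp add: bij_betw_def)
  then have f: "?P f"
    using mono by (auto intro: bij_imp_permutes simp: f_def)
  have "g = h" if "?P g" "?P h" for g h
  proof
    fix x
    have rev: "sorted_wrt (<) (rev (map g ?l))" "set (rev (map g ?l)) = A" if "?P g" for g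
    proof -
      show "sorted_wrt (<) (rev (map g ?l))"
        using l that unfolding sorted_wrt_rev sorted_wrt_map
        by (auto intro: sorted_wrt_mono_rel[OF _ l(1)] simp: monotone_on_def)
      show "set (rev (map g ?l)) = A"
        using l that by (simp add: permutes_image)
    qed
    have "rev (map g ?l) = rev (map h ?l)"
      using rev[OF \<open>?P g\<close>] rev[OF \<open>?P h\<close>] by (intro strict_sorted_equal) auto
    then have "g x = h x" if "x \<in> A"
      using that l(2) by (auto simp: map_eq_conv)
    moreover have "g x = h x" if "x \<notin> A"
      using that \<open>?P g\<close> \<open>?P h\<close> by (metis permutes_not_in)
    ultimately show "g x = h x" by blast
  qed
  then have "?P (order_reversal A)"
    unfolding order_reversal_def using f by (intro theI[of ?P f]) blast+
  then show "order_reversal A permutes A" "monotone_on A (<) (>) (order_reversal A)"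
    by auto
qed

section \<open>Counters of heights as lengths of decreasing subsequences\<close>

lemma height_Nil: "height [] = (\<lambda>_. 0)"
  by (auto simp: height_eq_0_iff fun_eq_iff)

lemma growth_height:
  assumes "sorted_wrt (<) as" "set w \<subseteq> set as"
  shows "growth (height w) 0 as"
  using assms(2)
proof (induction w rule: rev_induct)
  case Nil
  show ?case by (induction as) (auto simp: height_Nil)
next
  case (snoc x w)
  then obtain us vs where as: "as = us @ x # vs" by (auto dest: split_list)
  have "distinct as" using assms(1) by (simp add: strict_sorted_iff)
  with snoc show ?case
    using height_snoc[of us x vs w] growth_insert_height[of us x vs] assms(1) as by auto
qed

text \<open>Induction on \<open>w\<close>, by the place of the appended \<open>x\<close> relative to
  the interval \<open>vs\<close>: outside of it nothing changes on either side, inside it both sides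
  obey the same recursion. All intervals are treated at once because that recursion refers to the
  part of \<open>vs\<close> above \<open>x\<close>.\<close>

lemma dec_subseq_iff_climb:
  assumes "sorted_wrt (<) (us @ vs @ ts)" "set w \<subseteq> set (us @ vs @ ts)"
  shows "dec_subseq w (set vs) n \<longleftrightarrow> n \<le> climb (height w) 0 vs"
  using assms
proof (induction w arbitrary: us vs ts n rule: rev_induct)
  case Nil
  have "climb (height []) 0 vs = 0" by (induction vs) (auto simp: height_Nil)
  then show ?case by simp
next
  case (snoc x w)
  have dist: "distinct (us @ vs @ ts)" using snoc.prems(1) strict_sorted_iff by blast
  have IH: "dec_subseq w (set vs) n \<longleftrightarrow> n \<le> climb (height w) 0 vs"
    using snoc by auto
  consider "x \<in> set us" | "x \<in> set vs" | "x \<in> set ts" using snoc.prems by auto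
  then show ?case
  proof cases
    case 1
    then obtain p q where us: "us = p @ x # q" by (auto dest: split_list)
    have "height (w @ [x]) = insert_height x (q @ vs @ ts) (height w)"
      using snoc.prems us by (intro height_snoc[of p]) auto
    then have "climb (height (w @ [x])) 0 vs = climb (height w) 0 vs"
      using dist us by (simp add: climb_insert_height_right)
    then show ?thesis using IH dist us by (auto simp: dec_subseq_snoc)
  next
    case 3
    then obtain p q where ts: "ts = p @ x # q" by (auto dest: split_list)
    have "height (w @ [x]) = insert_height x q (height w)"
      using snoc.prems ts by (intro height_snoc[of "us @ vs @ p"]) auto
    then have "climb (height (w @ [x])) 0 vs = climb (height w) 0 vs"
      using dist ts by (subst climb_insert_height_notin[symmetric, of x vs q]) auto
    then show ?thesis using IH dist ts by (auto simp: dec_subseq_snoc)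
  next
    case 2
    then obtain p q where vs: "vs = p @ x # q" by (auto dest: split_list)
    have "height (w @ [x]) = insert_height x (q @ ts) (height w)"
      using snoc.prems vs by (intro height_snoc[of "us @ p"]) auto
    then have climb: "climb (height (w @ [x])) 0 vs = max (climb (height w) 0 vs) (Suc (climb (height w) 0 q))"
      using dist climb_insert_height[of p x q ts "height w"] unfolding vs by simp
    have "{y\<in>set vs. x < y} = set q"
      using snoc.prems(1) unfolding vs by (auto simp: sorted_wrt_append dest: order.asym)
    moreover have "dec_subseq w (set q) m \<longleftrightarrow> m \<le> climb (height w) 0 q" for m
      using snoc.IH[of "us @ p @ [x]" q ts m] snoc.prems vs by auto
    ultimately show ?thesis
      unfolding dec_subseq_snoc climb IH using vs by (cases n) (auto simp: le_max_iff_disj)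
  qed
qed

section \<open>Decreasing subsequences of the reversed word\<close>

lemma subseq_rev: "subseq u w \<Longrightarrow> subseq (rev u) (rev w)"
  by (induction rule: list_emb.induct) (auto intro: subseq_rev_drop_many)

text \<open>Reading backwards and reversing the order each turn decreasing into increasing; together
  they cancel.\<close>

lemma dec_subseq_rev_map:
  assumes "dec_subseq w S n" "monotone_on (set w) (<) (>) \<theta>"
  shows "dec_subseq (map \<theta> (rev w)) (\<theta> ` S) n"
proof -
  obtain u where u: "subseq u w" "sorted_wrt (>) u" "set u \<subseteq> S" "length u = n"
    using assms(1) by (auto simp: dec_subseq_def)
  have "set u \<subseteq> set w" using list_emb_set[OF u(1)] by blast
  then have "sorted_wrt (\<lambda>x y. \<theta> x < \<theta> y) u"
    using assms(2) by (intro sorted_wrt_mono_rel[OF _ u(2)]) (auto simp: monotone_on_def)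
  then have "sorted_wrt (>) (rev (map \<theta> u))"
    by (simp add: sorted_wrt_rev sorted_wrt_map)
  moreover have "subseq (rev (map \<theta> u)) (map \<theta> (rev w))"
    unfolding rev_map by (intro subseq_map subseq_rev u(1))
  ultimately show ?thesis
    using u(3,4) unfolding dec_subseq_def by (intro exI[of _ "rev (map \<theta> u)"]) auto
qed

lemma dec_subseq_reverse_word:
  assumes "finite A" "set w \<subseteq> A"
  shows "dec_subseq (reverse_word A w) (order_reversal A ` S) n \<longleftrightarrow> dec_subseq w S n"
proof
  let ?\<theta> = "order_reversal A"
  note \<theta> = order_reversal[OF assms(1)]
  have mono: "monotone_on (set w) (<) (>) ?\<theta>"
    using \<theta>(2) assms(2) by (rule monotone_on_subset)
  show "dec_subseq (reverse_word A w) (?\<theta> ` S) n" if "dec_subseq w S n"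
    using dec_subseq_rev_map[OF that mono] by (simp add: reverse_word_def)
  have inv: "inv ?\<theta> (?\<theta> x) = x" for x
    using permutes_inj[OF \<theta>(1)] by simp
  \<comment> \<open>The converse is the same lemma for the inverse permutation, which reverses the
    order on the letters of the reversed word.\<close>
  have "monotone_on (set (reverse_word A w)) (<) (>) (inv ?\<theta>)"
  proof (rule monotone_onI)
    fix x y assume "x \<in> set (reverse_word A w)" "y \<in> set (reverse_word A w)" "x < y"
    then obtain u v where uv: "x = ?\<theta> u" "y = ?\<theta> v" "u \<in> set w" "v \<in> set w"
      by (auto simp: reverse_word_def)
    have "v < u"
    proof (rule ccontr)
      assume "\<not> v < u"
      then have "u = v \<or> u < v" by auto
      then have "?\<theta> v \<le> ?\<theta> u"
        using monotone_onD[OF mono, of u v] uv by auto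
      then show False using \<open>x < y\<close> uv by simp
    qed
    then show "inv ?\<theta> y < inv ?\<theta> x" by (simp add: uv inv)
  qed
  from dec_subseq_rev_map[OF _ this, of "?\<theta> ` S" n]
  show "dec_subseq w S n" if "dec_subseq (reverse_word A w) (?\<theta> ` S) n"
    using that by (simp add: reverse_word_def rev_map image_image inv comp_def)
qed

section \<open>The partition of a word as level sets\<close>

text \<open>As the rows are nested, a letter of the \<open>i\<close>-th row that is missing from the
  next one lies in exactly \<open>i\<close> rows.\<close>

lemma row_differences_eq:
  "sorted_wrt (\<supseteq>) T \<Longrightarrow> row_differences T = (\<lambda>i. {z. row_count T z = i}) ` {1..length T}"
proof (induction T rule: row_differences.induct)
  case (2 R)
  then show ?case by (auto simp: row_count_Cons row_count_def)
next
  case (3 R S T)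
  let ?f = "row_count (S # T)"
  have eq: "row_count (R # S # T) = (\<lambda>z. if z \<in> R then Suc (?f z) else 0)"
    using 3(2) by (rule row_count_Cons)
  have f0: "?f z = 0 \<longleftrightarrow> z \<notin> S" for z
    using row_count_Cons[of S T] 3(2) by simp
  have "S \<subseteq> R" using 3(2) by simp
  have 1: "R - S = {z. row_count (R # S # T) z = 1}"
    unfolding eq using f0 by auto
  have 2: "{z. ?f z = i} = {z. row_count (R # S # T) z = Suc i}" if "i \<in> {1..length (S # T)}" for i
  proof -
    have "z \<in> R" if "?f z = i" for z
    proof -
      have "?f z \<noteq> 0" using that \<open>i \<in> _\<close> by simp
      then show ?thesis using f0[of z] \<open>S \<subseteq> R\<close> by auto
    qed
    then show ?thesis unfolding eq by auto
  qed
  have "{1..length (R # S # T)} = insert 1 (Suc ` {1..length (S # T)})"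
    by (auto simp: image_Suc_atLeastAtMost)
  moreover have "row_differences (S # T) = (\<lambda>i. {z. ?f z = i}) ` {1..length (S # T)}"
    using 3 by simp
  moreover have "\<dots> = (\<lambda>i. {z. row_count (R # S # T) z = Suc i}) ` {1..length (S # T)}"
    using 2 by (intro image_cong refl)
  ultimately show ?case
    by (simp only: row_differences.simps 1 image_insert image_image)
qed simp

lemma height_word_height:
  assumes "sorted_wrt (<) as" "set as = set w"
  shows "height_word (height w) as"
proof
  show "0 < height w z" if "z \<in> set as" for z
    using that height_eq_0_iff[of w z] assms(2) by simp
qed (use assms growth_height[of as w] in simp_all)

lemma N_partition_eq: "N_partition w = level_sets (height w) (set w)"
proof -
  define T where "T = N_tableau_of w"
  interpret height_word "height w" "sorted_list_of_set (set w)"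
    by (rule height_word_height) simp_all
  have T: "nested_rows T" unfolding T_def by (rule nested_rows_N_tableau_of)
  have image: "height w ` set w = {1..k}"
    using image_eq by simp
  \<comment> \<open>A letter of the top row lies in all rows, so the largest height is the number of
    rows.\<close>
  have "k = length T"
  proof (cases T rule: rev_cases)
    case Nil
    then have "set w = {}" using Union_N_tableau_of[of w] by (simp add: T_def)
    then show ?thesis using Nil by simp
  next
    case (snoc T' B)
    then obtain z where z: "z \<in> B" using T by (auto simp: nested_rows_def)
    have "\<forall>R\<in>set T. z \<in> R" using T z snoc by (auto simp: nested_rows_def sorted_wrt_append)
    then have "filter (\<lambda>R. z \<in> R) T = T" by simp
    then have "height w z = length T" by (simp add: height_def row_count_def T_def)
    moreover have "z \<in> set w"
      using Union_N_tableau_of[of w] z snoc by (auto simp: T_def)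
    ultimately have "length T \<in> {1..k}" using image by (metis imageI)
    moreover have "k \<le> length T"
    proof (cases "k = 0")
      case False
      then have "k \<in> height w ` set w" using image by simp
      then show ?thesis by (auto simp: height_def row_count_def T_def)
    qed simp
    ultimately show ?thesis by simp
  qed
  moreover have "sorted_wrt (\<supseteq>) T" using T by (simp add: nested_rows_def)
  ultimately have "N_partition w = (\<lambda>i. {z. height w z = i}) ` {1..k}"
    unfolding N_partition_def T_def[symmetric] height_def by (simp add: row_differences_eq)
  \<comment> \<open>Only letters of \<open>w\<close> have positive height.\<close>
  also have "\<dots> = (\<lambda>i. {z\<in>set w. height w z = i}) ` {1..k}"
  proof (intro image_cong refl)
    fix i assume "i \<in> {1..k}"
    then show "{z. height w z = i} = {z\<in>set w. height w z = i}"
      using height_eq_0_iff[of w] by (metis (lifting) atLeastAtMost_iff not_one_le_zero)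
  qed
  finally show ?thesis by (simp add: level_sets_def image)
qed

section \<open>Equal counters for a word and its reversal, and the conclusion\<close>

theorem theorem9p1:
  fixes A :: "'a::linorder set" and w :: "'a list"
  assumes "finite A" and "w \<in> lists A"
  shows "N_partition (reverse_word A w) = evac A (N_partition w)"
proof -
  let ?\<theta> = "order_reversal A" and ?v = "reverse_word A w"
  let ?rev = "\<lambda>us. rev (map ?\<theta> us)"
  define as where "as = sorted_list_of_set (set w)"
  have wA: "set w \<subseteq> A" using assms(2) by auto
  have as: "sorted_wrt (<) as" "set as = set w" by (simp_all add: as_def)
  have bs: "sorted_wrt (<) (?rev as)"
    using as wA order_reversal(2)[OF assms(1)] unfolding sorted_wrt_rev sorted_wrt_map
    by (intro sorted_wrt_mono_rel[OF _ as(1)]) (auto simp: monotone_on_def subset_iff)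
  have set_bs: "set (?rev as) = set ?v" by (simp add: as reverse_word_def)
  have "climb (height w) 0 vs = climb (height ?v) 0 (?rev vs)" if "as = us @ vs @ ts" for us vs ts
  proof -
    \<comment> \<open>The two counters are compared through all their lower bounds \<open>n\<close>,
      which are the lengths of decreasing subsequences.\<close>
    have "n \<le> climb (height w) 0 vs \<longleftrightarrow> n \<le> climb (height ?v) 0 (?rev vs)" for n
    proof -
      have "n \<le> climb (height w) 0 vs \<longleftrightarrow> dec_subseq w (set vs) n"
        using dec_subseq_iff_climb[of us vs ts w n] as unfolding that by simp
      also have "\<dots> \<longleftrightarrow> dec_subseq ?v (set (?rev vs)) n"
        using dec_subseq_reverse_word[OF assms(1) wA, of "set vs" n] by simp
      \<comment> \<open>The neighbours of the interval change sides: \<open>?rev ts\<close> now lies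
        below it and \<open>?rev us\<close> above.\<close>
      also have "\<dots> \<longleftrightarrow> n \<le> climb (height ?v) 0 (?rev vs)"
        using bs set_bs unfolding that
        by (intro dec_subseq_iff_climb[of "?rev ts" _ "?rev us"]) simp_all
      finally show ?thesis .
    qed
    then show ?thesis by (meson order_antisym order_refl)
  qed
  then have "level_sets (height ?v) (set (?rev as)) = evac A (level_sets (height w) (set as))"
    using as bs set_bs by (intro evac_level_sets height_word_height) auto
  then show ?thesis unfolding N_partition_eq set_bs as(2) .
qed

end
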